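(* Let $\rho\ge1$ and $0<\theta<\pi/2$ satisfy $0<\rho\cos\theta<1/2$, let $\Lambda\subset\mathbb{R}^2$ be the lattice generated by $(1,0)$ and $(\rho\cos\theta,\rho\sin\theta)$, and let $X=(X_1,X_2)$ be uniformly distributed on the Babai cell $\mathcal{B}(0)=(-1/2,1/2]\times(-\tfrac{\rho}{2}\sin\theta,\tfrac{\rho}{2}\sin\theta]$. Consider the single-round scheme with order $12$ (node $S_1$ speaks first) described in the context, with bin numbers $N_1,N_2$, messages $U_1,U_2$, error probability $P_{e,II}$ and rate $R=H(U_1)+H(U_2\mid U_1)$. Then for all positive integers $N_1,N_2$, $$P_{e,II}=\frac{\alpha_1}{N_1}+\frac{\alpha_2}{N_2},$$ and, with $N_1=N_1(N_2)=\left\lceil \dfrac{\alpha_1L_2N_2}{\alpha_2L_1}\right\rceil$, $$\lim_{N_2\to\infty}P_{e,II}\,2^{R/(1-P_0)}=\alpha_2\left(1+\frac{L_1}{L_2}\right)\left(\frac{\alpha_1L_2}{\alpha_2L_1}\right)^{\frac{L_1}{L_1+L_2}}2^{\frac{\kappa+H(\mathbf{P})}{1-P_0}},$$ where $R\to\infty$ as $N_2\to\infty$ and $$\kappa=\lim_{N_2\to\infty}H(U_2\mid U_1)=2\int_{-1/2}^{t_{-1}}H(Q(x))\,dx .$$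
   Context: $H(\cdot)$ applied to a probability vector or discrete random variable is Shannon entropy in bits. $\mathcal{V}(\lambda)$ denotes the set of $x\in\mathbb{R}^2$ for which $\lambda\in\Lambda$ is a closest lattice point. Node $S_i$ knows only $X_i$. Constants: $|\det V|=\rho\sin\theta$ (the area of $\mathcal{B}(0)$); $t_{-2}=(\rho\cos\theta-1)/2$, $t_{-1}=-(\rho\cos\theta)/2$, $t_1=-t_{-1}$, $t_2=-t_{-2}$; $I_{-2}=(-1/2,t_{-2}]$, $I_{-1}=(t_{-2},t_{-1}]$, $I_0=(t_{-1},t_1]$, $I_1=(t_1,t_2]$, $I_2=(t_2,1/2]$; $L_0,L_1,L_2$ are the lengths of $I_0,I_1,I_2$, so $L_0+2L_1+2L_2=1$; $P_i=L_i$ for $i=0,1,2$ and $\mathbf{P}=(P_0,P_1,P_1,P_2,P_2)$. Further $H_1=\dfrac{\cos\theta(1-\rho\cos\theta)}{2\sin\theta}$, $H_{22}=\dfrac{\rho\cos^2\theta}{2\sin\theta}$, $H_{21}=\dfrac{\cos\theta(1-2\rho\cos\theta)}{2\sin\theta}$, and $$\alpha_1=\frac{L_1H_{21}}{2|\det V|},\qquad \alpha_2=\frac{L_2(H_1+H_{22})}{2|\det V|}.$$ For $x\in(-1/2,1/2]$, let $[l(x),u(x)]$ be the closure of the set of $x_2$ with $(x,x_2)\in\mathcal{B}(0)\cap\mathcal{V}(0)$, and let $Q(x)=(Q_{-1}(x),Q_0(x),Q_1(x))$ be the probabilities of $X_2<l(x)$, $l(x)\le X_2\le u(x)$, $X_2>u(x)$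 respectively. Scheme. Each of $I_{-2},I_2$ is divided into $N_2$ equal-length bins, each of $I_{-1},I_1$ into $N_1$ equal-length bins, and $I_0$ is a single bin. $S_1$ sends the index $U_1$ of the bin containing $X_1$. If $m$ is the midpoint of that bin, $S_2$ replies with $U_2=1$ if $X_2>u(m)$, $U_2=-1$ if $X_2<l(m)$, and $U_2=0$ otherwise. Thus $(U_1,U_2)$ identifies a rectangle $\mathcal{R}\subset\mathcal{B}(0)$ containing $X$, and the common decision is a lattice point $\lambda$ maximizing $\mathrm{Area}(\mathcal{R}\cap\mathcal{V}(\lambda))$ (this is $\lambda=0$ when $U_2=0$). $P_{e,II}$ is the probability that the decision differs from the lattice point closest to $X$. *)

theory Defs
  imports "HOL-Probability.Probability"
begin

text \<open>The plane is \<^typ>\<open>real \<times> real\<close>; its \<^const>\<open>dist\<close> is the Euclidean distance and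
  \<^const>\<open>lborel\<close> on it is area.\<close>

definition lattice2 :: "real \<Rightarrow> real \<Rightarrow> (real \<times> real) set" where
  "lattice2 \<rho> \<theta> =
     {of_int a *\<^sub>R (1, 0) + of_int b *\<^sub>R (\<rho> * cos \<theta>, \<rho> * sin \<theta>) | a b :: int. True}"

definition voronoi :: "real \<Rightarrow> real \<Rightarrow> real \<times> real \<Rightarrow> (real \<times> real) set" where
  "voronoi \<rho> \<theta> p = {x. p \<in> lattice2 \<rho> \<theta> \<and> (\<forall>\<mu> \<in> lattice2 \<rho> \<theta>. dist x p \<le> dist x \<mu>)}"

definition babai_cell :: "real \<Rightarrow> real \<Rightarrow> (real \<times> real) set" where
  "babai_cell \<rho> \<theta> = {-(1/2)<..1/2} \<times> {-(\<rho> / 2 * sin \<theta>)<..\<rho> / 2 * sin \<theta>}"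

definition det_V :: "real \<Rightarrow> real \<Rightarrow> real" where
  "det_V \<rho> \<theta> = \<rho> * sin \<theta>"

text \<open>Breakpoints and intervals. The interval \<open>I\<^sub>j\<close> is \<open>{seg_lo j<..seg_hi j}\<close>; its index
  \<open>j\<close> is only meaningful in \<open>{-2..2}\<close>.\<close>

definition t1 :: "real \<Rightarrow> real \<Rightarrow> real" where "t1 \<rho> \<theta> = \<rho> * cos \<theta> / 2"
definition t2 :: "real \<Rightarrow> real \<Rightarrow> real" where "t2 \<rho> \<theta> = (1 - \<rho> * cos \<theta>) / 2"

definition seg_lo :: "real \<Rightarrow> real \<Rightarrow> int \<Rightarrow> real" where
  "seg_lo \<rho> \<theta> j =
     (if j = -2 then -(1/2) else if j = -1 then - t2 \<rho> \<theta> else if j = 0 then - t1 \<rho> \<theta>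
      else if j = 1 then t1 \<rho> \<theta> else t2 \<rho> \<theta>)"

definition seg_hi :: "real \<Rightarrow> real \<Rightarrow> int \<Rightarrow> real" where
  "seg_hi \<rho> \<theta> j =
     (if j = -2 then - t2 \<rho> \<theta> else if j = -1 then - t1 \<rho> \<theta> else if j = 0 then t1 \<rho> \<theta>
      else if j = 1 then t2 \<rho> \<theta> else 1/2)"

definition seg_len :: "real \<Rightarrow> real \<Rightarrow> int \<Rightarrow> real" where
  "seg_len \<rho> \<theta> j = seg_hi \<rho> \<theta> j - seg_lo \<rho> \<theta> j"

abbreviation "L0 \<rho> \<theta> \<equiv> seg_len \<rho> \<theta> 0"
abbreviation "L1 \<rho> \<theta> \<equiv> seg_len \<rho> \<theta> 1"
abbreviation "L2 \<rho> \<theta> \<equiv> seg_len \<rho> \<theta> 2"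

definition P_vec :: "real \<Rightarrow> real \<Rightarrow> real list" where
  "P_vec \<rho> \<theta> = [L0 \<rho> \<theta>, L1 \<rho> \<theta>, L1 \<rho> \<theta>, L2 \<rho> \<theta>, L2 \<rho> \<theta>]"

definition height1 :: "real \<Rightarrow> real \<Rightarrow> real" where
  "height1 \<rho> \<theta> = cos \<theta> * (1 - \<rho> * cos \<theta>) / (2 * sin \<theta>)"
definition height22 :: "real \<Rightarrow> real \<Rightarrow> real" where
  "height22 \<rho> \<theta> = \<rho> * (cos \<theta>)\<^sup>2 / (2 * sin \<theta>)"
definition height21 :: "real \<Rightarrow> real \<Rightarrow> real" where
  "height21 \<rho> \<theta> = cos \<theta> * (1 - 2 * \<rho> * cos \<theta>) / (2 * sin \<theta>)"

definition alpha1 :: "real \<Rightarrow> real \<Rightarrow> real" where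
  "alpha1 \<rho> \<theta> = L1 \<rho> \<theta> * height21 \<rho> \<theta> / (2 * \<bar>det_V \<rho> \<theta>\<bar>)"
definition alpha2 :: "real \<Rightarrow> real \<Rightarrow> real" where
  "alpha2 \<rho> \<theta> = L2 \<rho> \<theta> * (height1 \<rho> \<theta> + height22 \<rho> \<theta>) / (2 * \<bar>det_V \<rho> \<theta>\<bar>)"

text \<open>Entropy in bits of a finite probability vector; \<open>0 * log 2 0 = 0\<close> as usual.\<close>

definition vec_entropy :: "real list \<Rightarrow> real" where
  "vec_entropy ps = - (\<Sum>p\<leftarrow>ps. p * log 2 p)"

definition slice :: "real \<Rightarrow> real \<Rightarrow> real \<Rightarrow> real set" where
  "slice \<rho> \<theta> x = closure {y. (x, y) \<in> babai_cell \<rho> \<theta> \<inter> voronoi \<rho> \<theta> (0, 0)}"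

text \<open>For \<open>x \<in> {-1/2<..1/2}\<close> the slice is a nonempty compact interval, so these are its
  endpoints \<open>l(x)\<close> and \<open>u(x)\<close>.\<close>

definition l_end :: "real \<Rightarrow> real \<Rightarrow> real \<Rightarrow> real" where
  "l_end \<rho> \<theta> x = Inf (slice \<rho> \<theta> x)"
definition u_end :: "real \<Rightarrow> real \<Rightarrow> real \<Rightarrow> real" where
  "u_end \<rho> \<theta> x = Sup (slice \<rho> \<theta> x)"

definition Q_vec ::
  "real \<Rightarrow> real \<Rightarrow> 'a measure \<Rightarrow> ('a \<Rightarrow> real \<times> real) \<Rightarrow> real \<Rightarrow> real list" where
  "Q_vec \<rho> \<theta> M X x =
     [measure M {\<omega> \<in> space M. snd (X \<omega>) < l_end \<rho> \<theta> x},
      measure M {\<omega> \<in> space M. l_end \<rho> \<theta> x \<le> snd (X \<omega>) \<and> snd (X \<omega>) \<le> u_end \<rho> \<theta> x},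
      measure M {\<omega> \<in> space M. snd (X \<omega>) > u_end \<rho> \<theta> x}]"

text \<open>A bin is addressed by \<open>(j, k)\<close>: the \<open>k\<close>-th bin, counted from \<open>0\<close> on the left, of \<open>I\<^sub>j\<close>.\<close>

definition num_bins :: "nat \<Rightarrow> nat \<Rightarrow> int \<Rightarrow> nat" where
  "num_bins N1 N2 j = (if j = 0 then 1 else if \<bar>j\<bar> = 1 then N1 else N2)"

definition bin_indices :: "nat \<Rightarrow> nat \<Rightarrow> (int \<times> nat) set" where
  "bin_indices N1 N2 = (SIGMA j:{-2..2}. {..<num_bins N1 N2 j})"

definition bin_lo :: "real \<Rightarrow> real \<Rightarrow> nat \<Rightarrow> nat \<Rightarrow> int \<times> nat \<Rightarrow> real" where
  "bin_lo \<rho> \<theta> N1 N2 i =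
     seg_lo \<rho> \<theta> (fst i) + real (snd i) * (seg_len \<rho> \<theta> (fst i) / real (num_bins N1 N2 (fst i)))"
definition bin_hi :: "real \<Rightarrow> real \<Rightarrow> nat \<Rightarrow> nat \<Rightarrow> int \<times> nat \<Rightarrow> real" where
  "bin_hi \<rho> \<theta> N1 N2 i =
     seg_lo \<rho> \<theta> (fst i) + real (snd i + 1) * (seg_len \<rho> \<theta> (fst i) / real (num_bins N1 N2 (fst i)))"
definition bin_mid :: "real \<Rightarrow> real \<Rightarrow> nat \<Rightarrow> nat \<Rightarrow> int \<times> nat \<Rightarrow> real" where
  "bin_mid \<rho> \<theta> N1 N2 i = (bin_lo \<rho> \<theta> N1 N2 i + bin_hi \<rho> \<theta> N1 N2 i) / 2"

text \<open>The bins partition \<open>{-1/2<..1/2}\<close>; the value of \<open>msg1\<close> outside that set is irrelevant,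
  since the first coordinate of \<open>X\<close> lies in it almost surely.\<close>

definition msg1 :: "real \<Rightarrow> real \<Rightarrow> nat \<Rightarrow> nat \<Rightarrow> real \<Rightarrow> int \<times> nat" where
  "msg1 \<rho> \<theta> N1 N2 x1 =
     (THE i. i \<in> bin_indices N1 N2 \<and> x1 \<in> {bin_lo \<rho> \<theta> N1 N2 i<..bin_hi \<rho> \<theta> N1 N2 i})"

definition msg2 :: "real \<Rightarrow> real \<Rightarrow> nat \<Rightarrow> nat \<Rightarrow> int \<times> nat \<Rightarrow> real \<Rightarrow> int" where
  "msg2 \<rho> \<theta> N1 N2 i x2 =
     (let m = bin_mid \<rho> \<theta> N1 N2 i in
      if x2 > u_end \<rho> \<theta> m then 1 else if x2 < l_end \<rho> \<theta> m then -1 else 0)"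

definition U1 ::
  "real \<Rightarrow> real \<Rightarrow> nat \<Rightarrow> nat \<Rightarrow> ('a \<Rightarrow> real \<times> real) \<Rightarrow> 'a \<Rightarrow> int \<times> nat" where
  "U1 \<rho> \<theta> N1 N2 X \<omega> = msg1 \<rho> \<theta> N1 N2 (fst (X \<omega>))"
definition U2 ::
  "real \<Rightarrow> real \<Rightarrow> nat \<Rightarrow> nat \<Rightarrow> ('a \<Rightarrow> real \<times> real) \<Rightarrow> 'a \<Rightarrow> int" where
  "U2 \<rho> \<theta> N1 N2 X \<omega> = msg2 \<rho> \<theta> N1 N2 (U1 \<rho> \<theta> N1 N2 X \<omega>) (snd (X \<omega>))"

definition rectangle ::
  "real \<Rightarrow> real \<Rightarrow> nat \<Rightarrow> nat \<Rightarrow> int \<times> nat \<Rightarrow> int \<Rightarrow> (real \<times> real) set" where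
  "rectangle \<rho> \<theta> N1 N2 i v =
     {x \<in> babai_cell \<rho> \<theta>. msg1 \<rho> \<theta> N1 N2 (fst x) = i \<and> msg2 \<rho> \<theta> N1 N2 i (snd x) = v}"

text \<open>A decision rule assigns to every message pair some area-maximizing lattice point; how ties
  are broken is left open.\<close>

definition decision_rule ::
  "real \<Rightarrow> real \<Rightarrow> nat \<Rightarrow> nat \<Rightarrow> (int \<times> nat \<Rightarrow> int \<Rightarrow> real \<times> real) \<Rightarrow> bool" where
  "decision_rule \<rho> \<theta> N1 N2 dec \<longleftrightarrow>
     (\<forall>i \<in> bin_indices N1 N2. \<forall>v \<in> {-1, 0, 1}.
        is_arg_max (\<lambda>\<mu>. measure lborel (rectangle \<rho> \<theta> N1 N2 i v \<inter> voronoi \<rho> \<theta> \<mu>))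
          (\<lambda>\<mu>. \<mu> \<in> lattice2 \<rho> \<theta>) (dec i v))"

text \<open>An error occurs when the decision is not a closest lattice point to \<open>X\<close>. The closest
  lattice point is unique off a null set.\<close>

definition error_prob ::
  "real \<Rightarrow> real \<Rightarrow> nat \<Rightarrow> nat \<Rightarrow> 'a measure \<Rightarrow> ('a \<Rightarrow> real \<times> real)
    \<Rightarrow> (int \<times> nat \<Rightarrow> int \<Rightarrow> real \<times> real) \<Rightarrow> real" where
  "error_prob \<rho> \<theta> N1 N2 M X dec =
     measure M {\<omega> \<in> space M.
       X \<omega> \<notin> voronoi \<rho> \<theta> (dec (U1 \<rho> \<theta> N1 N2 X \<omega>) (U2 \<rho> \<theta> N1 N2 X \<omega>))}"

text \<open>Entropies of the messages, in the form of the library abbreviations \<open>\<H>(X)\<close> and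
  \<open>\<H>(X | Y)\<close> at base \<open>2\<close>.\<close>

definition bits :: "'a measure \<Rightarrow> ('a \<Rightarrow> 'b) \<Rightarrow> real" where
  "bits M Y = prob_space.entropy M 2 (count_space (Y ` space M)) Y"
definition cond_bits :: "'a measure \<Rightarrow> ('a \<Rightarrow> 'b) \<Rightarrow> ('a \<Rightarrow> 'c) \<Rightarrow> real" where
  "cond_bits M Y Z =
     prob_space.conditional_entropy M 2
       (count_space (Y ` space M)) (count_space (Z ` space M)) Y Z"

definition rate ::
  "real \<Rightarrow> real \<Rightarrow> nat \<Rightarrow> nat \<Rightarrow> 'a measure \<Rightarrow> ('a \<Rightarrow> real \<times> real) \<Rightarrow> real" where
  "rate \<rho> \<theta> N1 N2 M X =
     bits M (U1 \<rho> \<theta> N1 N2 X) + cond_bits M (U2 \<rho> \<theta> N1 N2 X) (U1 \<rho> \<theta> N1 N2 X)"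

definition N1_of :: "real \<Rightarrow> real \<Rightarrow> nat \<Rightarrow> nat" where
  "N1_of \<rho> \<theta> N2 =
     nat \<lceil>alpha1 \<rho> \<theta> * L2 \<rho> \<theta> * real N2 / (alpha2 \<rho> \<theta> * L1 \<rho> \<theta>)\<rceil>"

definition kappa :: "real \<Rightarrow> real \<Rightarrow> 'a measure \<Rightarrow> ('a \<Rightarrow> real \<times> real) \<Rightarrow> real" where
  "kappa \<rho> \<theta> M X =
     2 * integral {-(1/2)..- t1 \<rho> \<theta>} (\<lambda>x. vec_entropy (Q_vec \<rho> \<theta> M X x))"

end

theory Submission
  imports Defs
begin

text \<open>The Voronoi cell of \<open>0\<close> is the hexagon cut out by the six shortest lattice vectors, so
  inside the Babai cell it is bounded by the graphs of two piecewise linear functions \<open>l \<le> u\<close>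
  (\<open>ll\<close> and \<open>uu\<close> below), linear on each of the five segments. In a bin with midpoint \<open>m\<close> the scheme replaces \<open>u\<close> and \<open>l\<close>
  by the constants \<open>u m\<close> and \<open>l m\<close>; on the vertical line through \<open>x\<close> the errors fill the gaps
  \<open>\<bar>u x - u m\<bar>\<close> and \<open>\<bar>l x - l m\<bar>\<close>, and integrating them gives an error area that is quadratic in
  the bin width. The entropy of the first message is exactly
  \<open>H(P) + 2 L1 log N1 + 2 L2 log N2\<close>, and the conditional entropy of the second one is a midpoint
  Riemann sum of the continuous function \<open>H(Q(x))\<close>.\<close>

section \<open>The hexagonal Voronoi cell\<close>

text \<open>The decision is given only as a maximizer over infinitely many lattice points. It is
  pinned down without computing areas: on a segment one boundary is nondecreasing and the other
  nonincreasing in the same or the mirrored sense, so the expected Voronoi cell fills at least one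
  full half of each rectangle. The exponent \<open>1 / (1 - P0)\<close> comes from scaling. Doubling
  both bin numbers raises the entropy of the first message by
  \<open>2 * L1 + 2 * L2 = 1 - P0\<close> bits, so \<open>2 powr (R / (1 - P0))\<close> is, up to a
  convergent factor, homogeneous of degree 1 in \<open>(N1, N2)\<close>, while the error is
  homogeneous of degree -1. Their product is governed by \<open>N1 / N2\<close> alone, and the
  prescribed \<open>N1\<close> drives this ratio to the value that minimizes the limit. The heights
  inside \<open>alpha1\<close> and \<open>alpha2\<close> are the vertical changes of the two
  boundaries across one segment.\<close>

lemma int_le_square: "real_of_int m \<le> (real_of_int m)\<^sup>2"
proof -
  have "m \<le> m * m" by (cases "m \<le> 0") (auto intro: order_trans[OF _ zero_le_square] simp: mult_le_cancel_left1)
  then have "real_of_int m \<le> real_of_int (m * m)" by (simp only: of_int_le_iff)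
  then show ?thesis by (simp add: power2_eq_square)
qed

text \<open>The sector argument: every lattice vector is a non-negative integer combination of two
  neighbouring Voronoi vectors, which enclose a non-obtuse angle.\<close>

lemma nonneg_int_combination_inner_le:
  fixes p q z :: "real \<times> real" and m n :: int
  assumes "0 \<le> m" "0 \<le> n" "0 \<le> p \<bullet> q" "2 * (p \<bullet> z) \<le> p \<bullet> p" "2 * (q \<bullet> z) \<le> q \<bullet> q"
  defines "v \<equiv> of_int m *\<^sub>R p + of_int n *\<^sub>R q"
  shows "2 * (v \<bullet> z) \<le> v \<bullet> v"
proof -
  have "2 * (v \<bullet> z) = of_int m * (2 * (p \<bullet> z)) + of_int n * (2 * (q \<bullet> z))"
    unfolding v_def by (simp add: inner_add_left)
  also have "\<dots> \<le> of_int m * (p \<bullet> p) + of_int n * (q \<bullet> q)"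
    using assms by (intro add_mono mult_left_mono) auto
  \<comment> \<open>Integrality gives \<open>m <= m^2\<close> and \<open>n <= n^2\<close>; the
    non-obtuse angle makes the cross term non-negative.\<close>
  also have "\<dots> \<le> (of_int m)\<^sup>2 * (p \<bullet> p) + (of_int n)\<^sup>2 * (q \<bullet> q) + 2 * (of_int m * of_int n * (p \<bullet> q))"
    using int_le_square[of m] int_le_square[of n] assms
    by (intro add_increasing2 add_mono mult_right_mono) auto
  also have "\<dots> = v \<bullet> v"
    unfolding v_def by (simp add: inner_add_left inner_add_right inner_commute power2_eq_square algebra_simps)
  finally show ?thesis .
qed

lemma dist_le_iff_inner:
  fixes p \<mu> v :: "real \<times> real"
  shows "dist p \<mu> \<le> dist p (\<mu> + v) \<longleftrightarrow> 2 * (v \<bullet> (p - \<mu>)) \<le> v \<bullet> v"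
proof -
  have "dist p \<mu> \<le> dist p (\<mu> + v) \<longleftrightarrow> (dist p \<mu>)\<^sup>2 \<le> (dist p (\<mu> + v))\<^sup>2"
    by (simp add: abs_le_square_iff[symmetric])
  also have "\<dots> \<longleftrightarrow> (p - \<mu>) \<bullet> (p - \<mu>) \<le> (p - (\<mu> + v)) \<bullet> (p - (\<mu> + v))"
    by (simp add: dist_norm power2_norm_eq_inner)
  also have "\<dots> \<longleftrightarrow> 2 * (v \<bullet> (p - \<mu>)) \<le> v \<bullet> v"
    by (simp add: inner_diff_left inner_diff_right inner_add_left inner_add_right inner_commute algebra_simps)
  finally show ?thesis .
qed

lemma int_minus2_to_2_cases: "(j::int) \<in> {-2..2} \<Longrightarrow> j = -2 \<or> j = -1 \<or> j = 0 \<or> j = 1 \<or> j = 2"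
  by (simp, presburger)

section \<open>Lattice coordinates and the hexagon as Voronoi cell\<close>

locale babai =
  fixes \<rho> \<theta> :: real
  assumes rho_ge_1: "\<rho> \<ge> 1" and theta_pos: "0 < \<theta>" and theta_less: "\<theta> < pi / 2"
    and cos_pos: "0 < \<rho> * cos \<theta>" and cos_less: "\<rho> * cos \<theta> < 1 / 2"
begin

text \<open>The lattice is generated by \<open>(1, 0)\<close> and \<open>(c, s)\<close>;
  \<open>s\<close> is also the area of the Babai cell.\<close>

definition c :: real where "c = \<rho> * cos \<theta>"
definition s :: real where "s = \<rho> * sin \<theta>"

lemma c_pos: "0 < c" and c_less: "c < 1/2"
  using cos_pos cos_less by (auto simp: c_def)

lemma s_pos: "0 < s"
  using rho_ge_1 theta_pos theta_less by (auto simp: s_def intro!: mult_pos_pos sin_gt_zero)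

lemma norm_ge_1: "c\<^sup>2 + s\<^sup>2 \<ge> 1"
proof -
  have "c\<^sup>2 + s\<^sup>2 = \<rho>\<^sup>2 * ((cos \<theta>)\<^sup>2 + (sin \<theta>)\<^sup>2)"
    unfolding c_def s_def by (simp only: power_mult_distrib distrib_left)
  then show ?thesis using rho_ge_1 by (simp only: sin_cos_squared_add2 mult_1_right one_le_power)
qed

lemma s_sq_ge: "s\<^sup>2 \<ge> 3/4"
proof -
  have "c\<^sup>2 \<le> (1/2)\<^sup>2" using c_pos c_less by (intro power_mono) auto
  then show ?thesis using norm_ge_1 by (simp add: power2_eq_square)
qed

abbreviation \<Lambda> where "\<Lambda> \<equiv> lattice2 \<rho> \<theta>"
abbreviation V where "V \<equiv> voronoi \<rho> \<theta>"
abbreviation B where "B \<equiv> babai_cell \<rho> \<theta>"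

lemma lattice_iff: "p \<in> \<Lambda> \<longleftrightarrow> (\<exists>a b :: int. p = (of_int a + of_int b * c, of_int b * s))"
  by (simp add: lattice2_def c_def s_def)

lemma lattice_add: "p \<in> \<Lambda> \<Longrightarrow> q \<in> \<Lambda> \<Longrightarrow> p + q \<in> \<Lambda>"
  unfolding lattice_iff
  apply clarify
  subgoal for a a' b b' by (rule exI[of _ "a + a'"], rule exI[of _ "b + b'"]) (simp add: algebra_simps)
  done

lemma lattice_uminus: "p \<in> \<Lambda> \<Longrightarrow> - p \<in> \<Lambda>"
  unfolding lattice_iff
  apply clarify
  subgoal for a b by (rule exI[of _ "- a"], rule exI[of _ "- b"]) simp
  done

text \<open>The half-planes belong to plus and minus \<open>(1, 0)\<close>, \<open>(c, s)\<close>,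
  \<open>(c - 1, s)\<close>. These come from an obtuse superbase: \<open>(1, 0)\<close>,
  \<open>(c - 1, s)\<close> and \<open>- (c, s)\<close> sum to zero and have pairwise negative inner
  products.\<close>

definition hexagon :: "(real \<times> real) set" where
  "hexagon = {(x, y). \<bar>2 * x\<bar> \<le> 1 \<and> \<bar>2 * (c * x + s * y)\<bar> \<le> c\<^sup>2 + s\<^sup>2
     \<and> \<bar>2 * ((c - 1) * x + s * y)\<bar> \<le> (c - 1)\<^sup>2 + s\<^sup>2}"

lemma hexagon_uminus: "- p \<in> hexagon \<longleftrightarrow> p \<in> hexagon"
proof (cases p)
  case (Pair x y)
  have "2 * (c * - x + s * - y) = - (2 * (c * x + s * y))"
    "2 * ((c - 1) * - x + s * - y) = - (2 * ((c - 1) * x + s * y))" "2 * - x = - (2 * x)"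
    by (auto simp: algebra_simps)
  then show ?thesis unfolding Pair hexagon_def by (simp only: uminus_Pair mem_Collect_eq case_prod_conv abs_minus_cancel)
qed

text \<open>By \<open>dist_le_iff_inner\<close> the conclusion says that \<open>z\<close> is no
  farther from the origin than from \<open>v\<close>. Central symmetry of the hexagon reduces the
  claim to lattice vectors in the upper half-plane.\<close>

lemma hexagon_sector:
  assumes z: "z \<in> hexagon" and v: "v \<in> \<Lambda>"
  shows "2 * (v \<bullet> z) \<le> v \<bullet> v"
proof -
  have *: "2 * (v \<bullet> z) \<le> v \<bullet> v" if z: "z \<in> hexagon" and b: "b \<ge> 0"
    and v: "v = (of_int a + of_int b * c, of_int b * s)" for z v and a b :: int
  proof -
    let ?e = "(1, 0) :: real \<times> real" and ?f = "(c, s)" and ?g = "(c - 1, s)"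
    obtain x y where xy: "z = (x, y)" by (cases z)
    have h: "\<bar>2 * x\<bar> \<le> 1" "\<bar>2 * (c * x + s * y)\<bar> \<le> c\<^sup>2 + s\<^sup>2"
      "\<bar>2 * ((c - 1) * x + s * y)\<bar> \<le> (c - 1)\<^sup>2 + s\<^sup>2"
      using z by (auto simp: xy hexagon_def)
    have e: "2 * (?e \<bullet> z) \<le> ?e \<bullet> ?e" "2 * ((- ?e) \<bullet> z) \<le> (- ?e) \<bullet> (- ?e)"
      and f: "2 * (?f \<bullet> z) \<le> ?f \<bullet> ?f" and g: "2 * (?g \<bullet> z) \<le> ?g \<bullet> ?g"
      using h by (auto simp: xy power2_eq_square)
    have ip: "0 \<le> ?e \<bullet> ?f" "0 \<le> ?g \<bullet> ?f" "0 \<le> ?g \<bullet> (- ?e)"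
      using c_pos c_less norm_ge_1 by (auto simp: power2_eq_square algebra_simps)
    \<comment> \<open>One case for each sector of the upper half-plane between consecutive
      directions \<open>(1, 0)\<close>, \<open>(c, s)\<close>, \<open>(c - 1, s)\<close>,
      \<open>(-1, 0)\<close>.\<close>
    consider "a \<ge> 0" | "a < 0" "- a \<le> b" | "a < 0" "b < - a" by linarith
    then show ?thesis
    proof cases
      case 1
      have "v = of_int a *\<^sub>R ?e + of_int b *\<^sub>R ?f" by (simp add: v)
      then show ?thesis using nonneg_int_combination_inner_le[OF 1 b ip(1) e(1) f] by simp
    next
      case 2
      have "v = of_int (- a) *\<^sub>R ?g + of_int (b + a) *\<^sub>R ?f" by (simp add: v algebra_simps)
      then show ?thesis using nonneg_int_combination_inner_le[OF _ _ ip(2) g f, of "- a" "b + a"] 2 by simp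
    next
      case 3
      have "v = of_int b *\<^sub>R ?g + of_int (- a - b) *\<^sub>R (- ?e)" by (simp add: v algebra_simps)
      then show ?thesis using nonneg_int_combination_inner_le[OF _ _ ip(3) g e(2), of b "- a - b"] 3 b by simp
    qed
  qed
  obtain a b :: int where ab: "v = (of_int a + of_int b * c, of_int b * s)"
    using v by (auto simp: lattice_iff)
  show ?thesis
  proof (cases "b \<ge> 0")
    case True
    then show ?thesis using *[OF z _ ab] by simp
  next
    case False
    have "- v = (of_int (- a) + of_int (- b) * c, of_int (- b) * s)" by (simp add: ab)
    from *[OF _ _ this, of "- z"] False z show ?thesis by (simp add: hexagon_uminus)
  qed
qed

lemma relevant_in_lattice: "(1, 0) \<in> \<Lambda>" "(c, s) \<in> \<Lambda>" "(c - 1, s) \<in> \<Lambda>" "(0, 0) \<in> \<Lambda>"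
  unfolding lattice_iff
  by (rule exI[of _ 1], rule exI[of _ 0], simp,
      rule exI[of _ 0], rule exI[of _ 1], simp,
      rule exI[of _ "-1"], rule exI[of _ 1], simp,
      rule exI[of _ 0], rule exI[of _ 0], simp)

lemma voronoi_iff:
  assumes "\<mu> \<in> \<Lambda>"
  shows "p \<in> V \<mu> \<longleftrightarrow> p - \<mu> \<in> hexagon"
proof
  assume p: "p \<in> V \<mu>"
  have le: "2 * (v \<bullet> (p - \<mu>)) \<le> v \<bullet> v" if "v \<in> \<Lambda>" for v
    using p lattice_add[OF assms that] by (auto simp: voronoi_def dist_le_iff_inner[symmetric])
  obtain x y where xy: "p - \<mu> = (x, y)" by (cases "p - \<mu>")
  show "p - \<mu> \<in> hexagon"
    using relevant_in_lattice[THEN le] relevant_in_lattice[THEN lattice_uminus, THEN le]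
    by (simp add: xy hexagon_def power2_eq_square abs_le_iff) (simp add: algebra_simps)
next
  assume h: "p - \<mu> \<in> hexagon"
  have "dist p \<mu> \<le> dist p \<nu>" if "\<nu> \<in> \<Lambda>" for \<nu>
    using hexagon_sector[OF h, of "\<nu> - \<mu>"] lattice_add[OF that lattice_uminus[OF assms]]
      dist_le_iff_inner[of p \<mu> "\<nu> - \<mu>"] by simp
  then show "p \<in> V \<mu>" using assms by (simp add: voronoi_def)
qed

text \<open>The minimum of the top edge \<open>s/2\<close> of the Babai cell and the bisectors of
  the origin with \<open>(c - 1, s)\<close> and \<open>(c, s)\<close>. The common term
  \<open>s/2\<close> is pulled out, so that the largest of three deductions decides.\<close>

definition uu :: "real \<Rightarrow> real" where
  "uu x = s/2 - max 0 (max ((c - 1) * (1 - c + 2 * x)) (c * (2 * x - c))) / (2 * s)"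
definition ll :: "real \<Rightarrow> real" where "ll x = - uu (- x)"

lemma le_uu_iff: "y \<le> uu x \<longleftrightarrow> y \<le> s/2 \<and> 2 * (c * x + s * y) \<le> c\<^sup>2 + s\<^sup>2
     \<and> 2 * ((c - 1) * x + s * y) \<le> (c - 1)\<^sup>2 + s\<^sup>2"
proof -
  have "y \<le> uu x \<longleftrightarrow> max 0 (max ((c - 1) * (1 - c + 2 * x)) (c * (2 * x - c))) \<le> s\<^sup>2 - 2 * s * y"
    using s_pos unfolding uu_def by (simp add: field_simps power2_eq_square)
  also have "\<dots> \<longleftrightarrow> 2 * s * y \<le> s\<^sup>2 \<and> (c - 1) * (1 - c + 2 * x) \<le> s\<^sup>2 - 2 * s * y \<and> c * (2 * x - c) \<le> s\<^sup>2 - 2 * s * y"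
    by auto
  also have "2 * s * y \<le> s\<^sup>2 \<longleftrightarrow> y \<le> s/2" using s_pos by (auto simp: field_simps power2_eq_square)
  finally show ?thesis by (auto simp: algebra_simps power2_eq_square)
qed

lemma ll_le_iff: "ll x \<le> y \<longleftrightarrow> -(s/2) \<le> y \<and> - (2 * (c * x + s * y)) \<le> c\<^sup>2 + s\<^sup>2
     \<and> - (2 * ((c - 1) * x + s * y)) \<le> (c - 1)\<^sup>2 + s\<^sup>2"
  using le_uu_iff[of "- y" "- x"] unfolding ll_def by (auto simp: algebra_simps)

lemma B_iff: "(x, y) \<in> B \<longleftrightarrow> -(1/2) < x \<and> x \<le> 1/2 \<and> -(s/2) < y \<and> y \<le> s/2"
  by (auto simp: babai_cell_def s_def)

lemma voronoi_0_iff: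
  assumes "\<bar>x\<bar> \<le> 1/2" "-(s/2) \<le> y" "y \<le> s/2"
  shows "(x, y) \<in> V (0, 0) \<longleftrightarrow> ll x \<le> y \<and> y \<le> uu x"
  using assms by (auto simp: voronoi_iff[OF relevant_in_lattice(4)] hexagon_def le_uu_iff ll_le_iff abs_le_iff)

section \<open>Linear pieces and position of the boundary graphs\<close>

lemma uu_left: assumes "2 * x \<le> c - 1" shows "uu x = s/2 + (1 - c) * (1 - c + 2 * x) / (2 * s)"
proof -
  have "0 \<le> (c - 1) * (1 - c + 2 * x)" using assms c_less by (intro mult_nonpos_nonpos) auto
  moreover have "c * (2 * x - c) \<le> 0" using assms c_pos c_less by (intro mult_nonneg_nonpos) linarith+
  ultimately have "max 0 (max ((c - 1) * (1 - c + 2 * x)) (c * (2 * x - c))) = (c - 1) * (1 - c + 2 * x)"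
    by linarith
  then show ?thesis unfolding uu_def by (simp add: diff_divide_distrib algebra_simps)
qed

lemma uu_mid: assumes "c - 1 \<le> 2 * x" "2 * x \<le> c" shows "uu x = s/2"
proof -
  have "(c - 1) * (1 - c + 2 * x) \<le> 0" using assms c_less by (intro mult_nonpos_nonneg) auto
  moreover have "c * (2 * x - c) \<le> 0" using assms c_pos c_less by (intro mult_nonneg_nonpos) linarith+
  ultimately have "max 0 (max ((c - 1) * (1 - c + 2 * x)) (c * (2 * x - c))) = 0"
    by linarith
  then show ?thesis unfolding uu_def by (simp add: diff_divide_distrib algebra_simps)
qed

lemma uu_right: assumes "c \<le> 2 * x" shows "uu x = s/2 + c * (c - 2 * x) / (2 * s)"
proof -
  have "(c - 1) * (1 - c + 2 * x) \<le> 0" using assms c_less c_pos by (intro mult_nonpos_nonneg) auto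
  moreover have "0 \<le> c * (2 * x - c)" using assms c_pos c_less by (intro mult_nonneg_nonneg) auto
  ultimately have "max 0 (max ((c - 1) * (1 - c + 2 * x)) (c * (2 * x - c))) = c * (2 * x - c)"
    by linarith
  then show ?thesis unfolding uu_def by (simp add: diff_divide_distrib algebra_simps)
qed

lemma uu_le: "uu x \<le> s/2"
  using s_pos unfolding uu_def by auto

text \<open>Both deductions in \<open>uu\<close> are at most \<open>c * (1 - c) \<le> 1/4\<close> on
  the strip, whereas \<open>s^2\<close> is at least 3/4. Together with the mirrored bound for
  \<open>ll\<close> this separates the upper from the lower boundary by the horizontal axis.\<close>

lemma uu_pos: assumes "\<bar>x\<bar> \<le> 1/2" shows "0 < uu x"
proof -
  have "(c - 1) * (1 - c + 2 * x) \<le> (c - 1) * (-c)"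
    using assms c_less by (intro mult_left_mono_neg) auto
  also have "\<dots> \<le> 1/4" using sum_squares_ge_zero[of "c - 1/2" 0] by (simp add: algebra_simps)
  finally have 1: "(c - 1) * (1 - c + 2 * x) \<le> 1/4" .
  have "c * (2 * x - c) \<le> c * (1 - c)" using assms c_pos by (intro mult_left_mono) auto
  also have "\<dots> \<le> 1/4" using sum_squares_ge_zero[of "c - 1/2" 0] by (simp add: algebra_simps)
  finally have "max 0 (max ((c - 1) * (1 - c + 2 * x)) (c * (2 * x - c))) \<le> 1/4"
    using 1 by auto
  also have "1/4 < s\<^sup>2" using s_sq_ge by simp
  finally have "max 0 (max ((c - 1) * (1 - c + 2 * x)) (c * (2 * x - c))) / (2 * s) < s/2"
    using s_pos by (simp add: field_simps power2_eq_square)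
  then show ?thesis unfolding uu_def by simp
qed

lemma ll_neg: "\<bar>x\<bar> \<le> 1/2 \<Longrightarrow> ll x < 0" and ll_ge: "-(s/2) \<le> ll x"
  using uu_pos[of "- x"] uu_le[of "- x"] by (auto simp: ll_def)

text \<open>The Babai cell is open at its lower edge, so the uncompleted slice loses its lower
  endpoint where \<open>ll x = -(s/2)\<close>. It still lies between the open and the closed
  interval, and both have the same closure.\<close>

lemma slice_eq:
  assumes "-(1/2) < x" "x \<le> 1/2"
  shows "slice \<rho> \<theta> x = {ll x..uu x}"
proof -
  have lu: "ll x < uu x" using uu_pos[of x] ll_neg[of x] assms by linarith
  have eq: "{y. (x, y) \<in> B \<inter> V (0, 0)} = {-(s/2)<..s/2} \<inter> {ll x..uu x}"
    using assms voronoi_0_iff[of x] by (auto simp: B_iff abs_le_iff)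
  have "{ll x<..<uu x} \<subseteq> {-(s/2)<..s/2} \<inter> {ll x..uu x}"
    using uu_le[of x] ll_ge[of x] by auto
  from closure_mono[OF this] lu have "{ll x..uu x} \<subseteq> slice \<rho> \<theta> x"
    unfolding slice_def eq by simp
  moreover have "slice \<rho> \<theta> x \<subseteq> {ll x..uu x}"
    unfolding slice_def eq by (rule closure_minimal) auto
  ultimately show ?thesis by auto
qed

lemma ends_eq:
  assumes "-(1/2) < x" "x \<le> 1/2"
  shows "l_end \<rho> \<theta> x = ll x" "u_end \<rho> \<theta> x = uu x"
proof -
  have "ll x < uu x" using uu_pos[of x] ll_neg[of x] assms by linarith
  then show "l_end \<rho> \<theta> x = ll x" "u_end \<rho> \<theta> x = uu x"
    unfolding l_end_def u_end_def slice_eq[OF assms] by simp_all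
qed

text \<open>After translation by \<open>- (c - 1, s)\<close>, the bisector with the origin is one of
  the six half-plane conditions of the hexagon; given that one, the other five follow from the
  position of \<open>x\<close> and \<open>y\<close>.\<close>

lemma voronoi_upper_left:
  assumes "-(1/2) \<le> x" "2 * x \<le> c - 1" "-(s/2) \<le> y" "y \<le> s/2"
  shows "(x, y) \<in> V (c - 1, s) \<longleftrightarrow> uu x \<le> y"
proof -
  have "uu x \<le> y \<longleftrightarrow> s\<^sup>2 + (1 - c) * (1 - c + 2 * x) \<le> 2 * s * y"
    using s_pos unfolding uu_left[OF assms(2)] by (simp add: field_simps power2_eq_square)
  also have "\<dots> \<longleftrightarrow> (x - (c - 1), y - s) \<in> hexagon" (is "?h \<longleftrightarrow> _")
  proof
    assume h: ?h
    \<comment> \<open>Bounds on \<open>x\<close> and \<open>y\<close> multiplied by positive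
      constants; with these products the remaining half-plane conditions become linear.\<close>
    have "c * (2 * x) \<le> c * (c - 1)" "c * (- 1) \<le> c * (2 * x)" "(1 - c) * (- 1) \<le> (1 - c) * (2 * x)"
      "s * y \<le> s * (s/2)"
      using assms c_pos c_less s_pos by (intro mult_left_mono; simp add: field_simps)+
    moreover have "0 \<le> (1 - c)\<^sup>2" by simp
    ultimately show "(x - (c - 1), y - s) \<in> hexagon"
      using h assms c_pos c_less s_sq_ge
      unfolding hexagon_def mem_Collect_eq prod.case abs_le_iff power2_eq_square
      by (intro conjI; simp add: algebra_simps)
  qed (simp only: hexagon_def mem_Collect_eq prod.case abs_le_iff power2_eq_square, simp add: algebra_simps)
  finally show ?thesis by (simp add: voronoi_iff relevant_in_lattice)
qed

lemma voronoi_upper_right: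
  assumes "c \<le> 2 * x" "x \<le> 1/2" "-(s/2) \<le> y" "y \<le> s/2"
  shows "(x, y) \<in> V (c, s) \<longleftrightarrow> uu x \<le> y"
proof -
  have "uu x \<le> y \<longleftrightarrow> s\<^sup>2 + c * (c - 2 * x) \<le> 2 * s * y"
    using s_pos unfolding uu_right[OF assms(1)] by (simp add: field_simps power2_eq_square)
  also have "\<dots> \<longleftrightarrow> (x - c, y - s) \<in> hexagon" (is "?h \<longleftrightarrow> _")
  proof
    assume h: ?h
    have "(1 - c) * c \<le> (1 - c) * (2 * x)" "s * y \<le> s * (s/2)"
      using assms c_pos c_less s_pos by (intro mult_left_mono; simp add: field_simps)+
    moreover have "c * (2 * x) \<le> 1/2 * 1"
      using assms c_pos c_less by (intro mult_mono) auto
    moreover have "0 \<le> c * c" by simp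
    ultimately show "(x - c, y - s) \<in> hexagon"
      using h assms c_pos c_less s_sq_ge
      unfolding hexagon_def mem_Collect_eq prod.case abs_le_iff power2_eq_square
      by (intro conjI; simp only: algebra_simps; linarith)
  qed (simp only: hexagon_def mem_Collect_eq prod.case abs_le_iff power2_eq_square, simp add: algebra_simps)
  finally show ?thesis by (simp add: voronoi_iff relevant_in_lattice)
qed

text \<open>Central symmetry of the lattice, used to carry statements about the upper boundary over
  to the lower one.\<close>

lemma voronoi_uminus: "p \<in> V (- \<mu>) \<longleftrightarrow> - p \<in> V \<mu>"
proof (cases "\<mu> \<in> \<Lambda>")
  case True
  show ?thesis using hexagon_uminus[of "p + \<mu>"]
    unfolding voronoi_iff[OF True] voronoi_iff[OF lattice_uminus[OF True]]
    by (simp add: minus_diff_commute)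
next
  case False
  then have "- \<mu> \<notin> \<Lambda>" using lattice_uminus[of "- \<mu>"] by auto
  then show ?thesis using False by (simp add: voronoi_def)
qed

end

section \<open>Segments, bins and rectangles\<close>

context babai begin

lemma seg_simps:
  "seg_lo \<rho> \<theta> (-2) = -(1/2)" "seg_lo \<rho> \<theta> (-1) = (c - 1)/2" "seg_lo \<rho> \<theta> 0 = - c/2"
  "seg_lo \<rho> \<theta> 1 = c/2" "seg_lo \<rho> \<theta> 2 = (1 - c)/2"
  "seg_hi \<rho> \<theta> (-2) = (c - 1)/2" "seg_hi \<rho> \<theta> (-1) = -c/2" "seg_hi \<rho> \<theta> 0 = c/2"
  "seg_hi \<rho> \<theta> 1 = (1 - c)/2" "seg_hi \<rho> \<theta> 2 = 1/2"
  "seg_len \<rho> \<theta> (-2) = c/2" "seg_len \<rho> \<theta> (-1) = (1 - 2 * c)/2" "seg_len \<rho> \<theta> 0 = c"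
  "seg_len \<rho> \<theta> 1 = (1 - 2 * c)/2" "seg_len \<rho> \<theta> 2 = c/2"
  by (simp_all add: seg_lo_def seg_hi_def seg_len_def t1_def t2_def c_def[symmetric] field_simps)

lemma seg_len_pos: "j \<in> {-2..2} \<Longrightarrow> 0 < seg_len \<rho> \<theta> j"
  using int_minus2_to_2_cases[of j] c_pos c_less by (auto simp: seg_simps simp del: atLeastAtMost_iff)

lemma seg_bounds: "j \<in> {-2..2} \<Longrightarrow> -(1/2) \<le> seg_lo \<rho> \<theta> j \<and> seg_hi \<rho> \<theta> j \<le> 1/2"
  using int_minus2_to_2_cases[of j] c_pos c_less by (auto simp: seg_simps simp del: atLeastAtMost_iff)

lemma seg_unique:
  assumes "j \<in> {-2..2}" "j' \<in> {-2..2}" "x \<in> {seg_lo \<rho> \<theta> j<..seg_hi \<rho> \<theta> j}"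
    "x \<in> {seg_lo \<rho> \<theta> j'<..seg_hi \<rho> \<theta> j'}"
  shows "j = j'"
  using int_minus2_to_2_cases[OF assms(1)] int_minus2_to_2_cases[OF assms(2)] assms(3,4) c_pos c_less
  by (elim disjE; simp add: seg_simps)

lemma seg_exists:
  assumes "-(1/2) < x" "x \<le> 1/2"
  shows "\<exists>j\<in>{-2..2}. x \<in> {seg_lo \<rho> \<theta> j<..seg_hi \<rho> \<theta> j}"
proof -
  consider "x \<in> {seg_lo \<rho> \<theta> (-2)<..seg_hi \<rho> \<theta> (-2)}" | "x \<in> {seg_lo \<rho> \<theta> (-1)<..seg_hi \<rho> \<theta> (-1)}"
    | "x \<in> {seg_lo \<rho> \<theta> 0<..seg_hi \<rho> \<theta> 0}" | "x \<in> {seg_lo \<rho> \<theta> 1<..seg_hi \<rho> \<theta> 1}"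
    | "x \<in> {seg_lo \<rho> \<theta> 2<..seg_hi \<rho> \<theta> 2}"
    using assms unfolding seg_simps by fastforce
  then show ?thesis
    by cases (rule bexI, assumption, simp)+
qed

text \<open>The second coordinates in the Babai cell that trigger reply \<open>v\<close> when the
  bin has midpoint \<open>x\<close>; the last branch stands for \<open>v = -1\<close>.\<close>

definition reply_interval :: "real \<Rightarrow> int \<Rightarrow> real set" where
  "reply_interval x v = {-(s/2)<..s/2} \<inter>
     (if v = 1 then {uu x<..} else if v = 0 then {ll x..uu x} else {..<ll x})"

lemma reply_interval_borel: "reply_interval x v \<in> sets borel"
  by (simp add: reply_interval_def)

end

locale babai_bins = babai +
  fixes N1 N2 :: nat
  assumes N_pos: "0 < N1" "0 < N2"
begin

abbreviation "nb j \<equiv> num_bins N1 N2 j"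
abbreviation "bins \<equiv> bin_indices N1 N2"
abbreviation "blo \<equiv> bin_lo \<rho> \<theta> N1 N2"
abbreviation "bhi \<equiv> bin_hi \<rho> \<theta> N1 N2"
abbreviation "bmid \<equiv> bin_mid \<rho> \<theta> N1 N2"
abbreviation "width j \<equiv> seg_len \<rho> \<theta> j / real (nb j)"

lemma nb_pos: "0 < nb j" using N_pos by (simp add: num_bins_def)

lemma width_pos: "j \<in> {-2..2} \<Longrightarrow> 0 < width j"
  using nb_pos[of j] seg_len_pos by simp

lemma finite_bins: "finite bins" by (simp add: bin_indices_def)

lemma bins_iff: "(j, k) \<in> bins \<longleftrightarrow> j \<in> {-2..2} \<and> k < nb j" by (auto simp: bin_indices_def)

lemma bin_ends: "blo (j, k) = seg_lo \<rho> \<theta> j + real k * width j"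
  "bhi (j, k) = seg_lo \<rho> \<theta> j + (real k + 1) * width j"
  by (simp_all add: bin_lo_def bin_hi_def add.commute)

lemma bin_mid_eq: "blo (j, k) = bmid (j, k) - width j / 2" "bhi (j, k) = bmid (j, k) + width j / 2"
  unfolding bin_mid_def bin_ends by (simp_all add: algebra_simps add_divide_distrib)

lemma bin_subset_seg:
  assumes "(j, k) \<in> bins"
  shows "seg_lo \<rho> \<theta> j \<le> blo (j, k)" "blo (j, k) < bhi (j, k)" "bhi (j, k) \<le> seg_hi \<rho> \<theta> j"
proof -
  have j: "j \<in> {-2..2}" and k: "real k + 1 \<le> real (nb j)"
    using assms nb_pos[of j] by (auto simp: bins_iff)
  have "(real k + 1) * width j \<le> real (nb j) * width j"
    using k width_pos[OF j] by (intro mult_right_mono) auto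
  also have "\<dots> = seg_len \<rho> \<theta> j" using nb_pos[of j] by simp
  finally show "bhi (j, k) \<le> seg_hi \<rho> \<theta> j" by (simp add: bin_ends seg_len_def)
  show "blo (j, k) < bhi (j, k)" using width_pos[OF j] unfolding bin_mid_eq by simp
  show "seg_lo \<rho> \<theta> j \<le> blo (j, k)" using mult_nonneg_nonneg[OF _ less_imp_le[OF width_pos[OF j]], of "real k"]
    unfolding bin_ends by linarith
qed

lemma bin_bounds:
  assumes "i \<in> bins"
  shows "-(1/2) \<le> blo i" "blo i < bmid i" "bmid i < bhi i" "bhi i \<le> 1/2"
proof -
  obtain j k where i: "i = (j, k)" by (cases i)
  have j: "j \<in> {-2..2}" using assms by (simp add: i bins_iff)
  show "-(1/2) \<le> blo i" "blo i < bmid i" "bmid i < bhi i" "bhi i \<le> 1/2"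
    using bin_subset_seg[of j k] assms seg_bounds[OF j] width_pos[OF j] by (auto simp: i bin_mid_eq)
qed

lemma bin_unique:
  assumes "i \<in> bins" "i' \<in> bins" "x \<in> {blo i<..bhi i}" "x \<in> {blo i'<..bhi i'}"
  shows "i = i'"
proof -
  obtain j k j' k' where i: "i = (j, k)" "i' = (j', k')" by (cases i; cases i')
  have j: "j \<in> {-2..2}" "j' \<in> {-2..2}" using assms by (auto simp: i bins_iff)
  have jj: "j = j'"
    using bin_subset_seg[OF assms(1)[unfolded i]] bin_subset_seg[OF assms(2)[unfolded i]] assms(3,4)
    by (intro seg_unique[OF j, of x]) (auto simp: i)
  have "real k * width j < (real k' + 1) * width j" "real k' * width j < (real k + 1) * width j"
    using assms(3,4) by (auto simp: i jj bin_ends)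
  then have "real k < real k' + 1" "real k' < real k + 1"
    using width_pos[OF j(1)] by (simp_all only: mult_less_cancel_right_pos)
  then show ?thesis by (auto simp: i jj)
qed

lemma bin_exists:
  assumes "-(1/2) < x" "x \<le> 1/2"
  shows "\<exists>i\<in>bins. x \<in> {blo i<..bhi i}"
proof -
  obtain j where j: "j \<in> {-2..2}" and x: "seg_lo \<rho> \<theta> j < x" "x \<le> seg_hi \<rho> \<theta> j"
    using seg_exists[OF assms] by auto
  let ?q = "(x - seg_lo \<rho> \<theta> j) / width j"
  have q: "0 < ?q" using x seg_len_pos[OF j] nb_pos[of j] by simp
  have "?q \<le> seg_len \<rho> \<theta> j / width j"
    using x width_pos[OF j] by (intro divide_right_mono) (auto simp: seg_len_def)
  also have "\<dots> = real (nb j)" using seg_len_pos[OF j] by simp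
  finally have q': "?q \<le> real (nb j)" .
  \<comment> \<open>Bins are open on the left and closed on the right, hence ceiling minus one
    instead of the floor; \<open>0 < ?q\<close> keeps it non-negative.\<close>
  define k where "k = nat (\<lceil>?q\<rceil> - 1)"
  have k: "real k < ?q" "?q \<le> real k + 1" using q unfolding k_def by linarith+
  have "real k * width j < x - seg_lo \<rho> \<theta> j" "x - seg_lo \<rho> \<theta> j \<le> (real k + 1) * width j"
    using k width_pos[OF j] by (simp_all only: pos_less_divide_eq pos_divide_le_eq)
  then have "x \<in> {blo (j, k)<..bhi (j, k)}" by (auto simp: bin_ends)
  moreover have "k < nb j" using k(1) q' by linarith
  ultimately show ?thesis using j by (auto simp: bins_iff)
qed

lemma
  assumes "-(1/2) < x" "x \<le> 1/2"
  shows msg1_eq_iff: "i \<in> bins \<Longrightarrow> msg1 \<rho> \<theta> N1 N2 x = i \<longleftrightarrow> x \<in> {blo i<..bhi i}"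
    and msg1_in_bins: "msg1 \<rho> \<theta> N1 N2 x \<in> bins"
proof -
  obtain i' where i': "i' \<in> bins" "x \<in> {blo i'<..bhi i'}" using bin_exists assms by blast
  have "msg1 \<rho> \<theta> N1 N2 x = i'"
    unfolding msg1_def using i' bin_unique by (intro the_equality) blast+
  then show "i \<in> bins \<Longrightarrow> msg1 \<rho> \<theta> N1 N2 x = i \<longleftrightarrow> x \<in> {blo i<..bhi i}" "msg1 \<rho> \<theta> N1 N2 x \<in> bins"
    using i' assms bin_unique by blast+
qed

text \<open>Outside the strip the description in \<open>msg1\<close> is unsatisfiable, so
  \<open>THE\<close> yields one fixed but unknown index.\<close>

lemma msg1_outside:
  assumes "\<not> (-(1/2) < x \<and> x \<le> 1/2)"
  shows "msg1 \<rho> \<theta> N1 N2 x = (THE i. False)"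
proof -
  have "(i \<in> bins \<and> x \<in> {blo i<..bhi i}) = False" for i
    using bin_bounds[of i] assms by auto
  then show ?thesis unfolding msg1_def by (simp only:)
qed

lemma msg1_measurable: "msg1 \<rho> \<theta> N1 N2 \<in> borel \<rightarrow>\<^sub>M count_space UNIV"
proof -
  have "msg1 \<rho> \<theta> N1 N2 -` {i} \<in> sets borel" for i
  proof -
    let ?O = "{-(1/2)<..1/2} :: real set"
    \<comment> \<open>The fallback index could coincide with a genuine bin; therefore the fibre is a
      union of two contributions rather than one of two alternatives.\<close>
    have "msg1 \<rho> \<theta> N1 N2 -` {i} = (if i \<in> bins then {blo i<..bhi i} \<inter> ?O else {})
        \<union> (if i = (THE i. False) then - ?O else {})"
    proof (intro set_eqI)
      fix x
      show "x \<in> msg1 \<rho> \<theta> N1 N2 -` {i} \<longleftrightarrow> x \<in> (if i \<in> bins then {blo i<..bhi i} \<inter> ?O else {})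
        \<union> (if i = (THE i. False) then - ?O else {})"
      proof (cases "x \<in> ?O")
        case True
        then show ?thesis using msg1_eq_iff[of x i] msg1_in_bins[of x] by auto
      next
        case False
        then show ?thesis using msg1_outside[of x] by auto
      qed
    qed
    then show ?thesis by simp
  qed
  then show ?thesis by (subst measurable_count_space_eq_countable) auto
qed

lemma msg2_eq:
  assumes "i \<in> bins"
  shows "msg2 \<rho> \<theta> N1 N2 i y = (if uu (bmid i) < y then 1 else if y < ll (bmid i) then -1 else 0)"
  using ends_eq[of "bmid i"] bin_bounds[OF assms] by (simp add: msg2_def Let_def)

lemma rectangle_eq:
  assumes "i \<in> bins" "v \<in> {-1, 0, 1}"
  shows "rectangle \<rho> \<theta> N1 N2 i v = {blo i<..bhi i} \<times> reply_interval (bmid i) v"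
proof -
  have lu: "ll (bmid i) < uu (bmid i)"
    using uu_pos[of "bmid i"] ll_neg[of "bmid i"] bin_bounds[OF assms(1)] by linarith
  have x: "x \<in> {-(1/2)<..1/2} \<and> msg1 \<rho> \<theta> N1 N2 x = i \<longleftrightarrow> x \<in> {blo i<..bhi i}" for x
    using bin_bounds[OF assms(1)] msg1_eq_iff[OF _ _ assms(1), of x] by auto
  have y: "y \<in> {-(s/2)<..s/2} \<and> msg2 \<rho> \<theta> N1 N2 i y = v \<longleftrightarrow> y \<in> reply_interval (bmid i) v" for y
    using assms(2) lu unfolding msg2_eq[OF assms(1)] reply_interval_def by auto
  have "(a, b) \<in> rectangle \<rho> \<theta> N1 N2 i v \<longleftrightarrow> a \<in> {blo i<..bhi i} \<and> b \<in> reply_interval (bmid i) v" for a b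
    unfolding x[symmetric] y[symmetric] by (auto simp: rectangle_def B_iff)
  then show ?thesis by auto
qed

end

section \<open>Error area of a bin\<close>

text \<open>Cavalieri's principle. Only slices over the open interval are prescribed, since the two
  end slices lie over a null set; this suits half-open bins.\<close>

lemma area_slices:
  fixes S :: "(real \<times> real) set"
  assumes S: "S \<in> sets borel" "S \<subseteq> {a..b} \<times> UNIV"
    and slices: "\<And>x. x \<in> {a<..<b} \<Longrightarrow> emeasure lborel {y. (x, y) \<in> S} = ennreal (f x)"
    and nonneg: "\<And>x. x \<in> {a<..<b} \<Longrightarrow> 0 \<le> f x"
    and I: "(f has_integral I) {a..b}"
  shows "emeasure lborel S = ennreal I"
proof -
  have "S \<in> sets (lborel \<Otimes>\<^sub>M lborel)" using S(1) by (subst lborel_prod) simp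
  from lborel.emeasure_pair_measure_alt[OF this]
  have "emeasure lborel S = (\<integral>\<^sup>+x. emeasure lborel (Pair x -` S) \<partial>lborel)"
    by (subst (asm) lborel_prod)
  also have "\<dots> = (\<integral>\<^sup>+x. ennreal (f x) * indicator {a<..<b} x \<partial>lborel)"
  proof (rule nn_integral_cong_AE)
    have "AE x in lborel. x \<noteq> a \<and> x \<noteq> b" using AE_lborel_singleton[of a] AE_lborel_singleton[of b] by eventually_elim auto
    then show "AE x in lborel. emeasure lborel (Pair x -` S) = ennreal (f x) * indicator {a<..<b} x"
    proof eventually_elim
      case (elim x)
      show ?case
      proof (cases "x \<in> {a<..<b}")
        case True
        then show ?thesis using slices[OF True] by (simp add: vimage_def)
      next
        case False
        then have "Pair x -` S = {}" using elim S(2) by auto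
        then show ?thesis using False by simp
      qed
    qed
  qed
  also have "\<dots> = ennreal I"
    using nonneg I by (intro nn_integral_has_integral_lebesgue') (auto simp: has_integral_Icc_iff_Ioo)
  finally show ?thesis .
qed

lemma has_integral_abs_symmetric:
  assumes "0 \<le> h"
  shows "((\<lambda>x::real. \<bar>x - m\<bar>) has_integral h\<^sup>2) {m - h..m + h}"
proof -
  have "((\<lambda>x. m - x) has_integral (- ((m - m)\<^sup>2 / 2) - (- ((m - (m - h))\<^sup>2 / 2)))) {m - h..m}"
    using assms by (intro fundamental_theorem_of_calculus)
      (auto intro!: derivative_eq_intros simp: has_real_derivative_iff_has_vector_derivative[symmetric] field_simps)
  then have 1: "((\<lambda>x. \<bar>x - m\<bar>) has_integral h\<^sup>2 / 2) {m - h..m}"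
    by (rule has_integral_eq[rotated, where f = "\<lambda>x. m - x", THEN has_integral_eq_rhs]) auto
  have "((\<lambda>x. x - m) has_integral (((m + h - m)\<^sup>2 / 2) - ((m - m)\<^sup>2 / 2))) {m..m + h}"
    using assms by (intro fundamental_theorem_of_calculus)
      (auto intro!: derivative_eq_intros simp: has_real_derivative_iff_has_vector_derivative[symmetric])
  then have 2: "((\<lambda>x. \<bar>x - m\<bar>) has_integral h\<^sup>2 / 2) {m..m + h}"
    by (rule has_integral_eq[rotated, where f = "\<lambda>x. x - m", THEN has_integral_eq_rhs]) auto
  show ?thesis using has_integral_combine[OF _ _ 1 2] assms by simp
qed

lemma measure_lborel_Times:
  fixes A B :: "real set"
  assumes "A \<in> sets borel" "B \<in> sets borel"
  shows "measure lborel (A \<times> B) = measure lborel A * measure lborel B"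
  using assms unfolding lborel_prod[symmetric] measure_def
  by (subst lborel.emeasure_pair_measure_Times) (auto simp: enn2real_mult)

context babai begin

lemma voronoi_borel: "V \<mu> \<in> sets borel"
proof (cases "\<mu> \<in> \<Lambda>")
  case True
  then have "V \<mu> = (\<Inter>\<nu>\<in>\<Lambda>. {x. dist x \<mu> \<le> dist x \<nu>})" by (auto simp: voronoi_def)
  moreover have "closed {x. dist x \<mu> \<le> dist x \<nu>}" for \<nu>
    by (intro closed_Collect_le continuous_intros)
  ultimately show ?thesis by (intro borel_closed) auto
qed (simp add: voronoi_def)

text \<open>Common points are equidistant from the two lattice points and hence lie on their
  perpendicular bisector.\<close>

lemma voronoi_Int_null:
  assumes "\<mu> \<noteq> \<nu>"
  shows "V \<mu> \<inter> V \<nu> \<in> null_sets lborel"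
proof -
  have "V \<mu> \<inter> V \<nu> \<subseteq> {x. (\<nu> - \<mu>) \<bullet> x = ((\<nu> - \<mu>) \<bullet> (\<nu> + \<mu>)) / 2}"
  proof
    fix x assume x: "x \<in> V \<mu> \<inter> V \<nu>"
    then have "dist x \<mu> = dist x \<nu>" by (auto simp: voronoi_def intro: antisym)
    then have "(x - \<mu>) \<bullet> (x - \<mu>) = (x - \<nu>) \<bullet> (x - \<nu>)"
      by (metis dist_norm power2_norm_eq_inner)
    then show "x \<in> {x. (\<nu> - \<mu>) \<bullet> x = ((\<nu> - \<mu>) \<bullet> (\<nu> + \<mu>)) / 2}"
      by (simp add: inner_diff_left inner_diff_right inner_add_right inner_commute)
  qed
  moreover have "negligible {x. (\<nu> - \<mu>) \<bullet> x = ((\<nu> - \<mu>) \<bullet> (\<nu> + \<mu>)) / 2}"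
    using assms by (intro negligible_hyperplane) auto
  ultimately have "negligible (V \<mu> \<inter> V \<nu>)" by (rule negligible_subset[rotated])
  then show ?thesis
    using voronoi_borel by (auto simp: negligible_iff_null_sets null_sets_completion_iff)
qed

text \<open>Distinct Voronoi cells overlap in a null set, so a cell that covers at least half of \<open>R\<close>
  already attains the maximal area; ties need no separate treatment.\<close>

lemma measure_diff_voronoi_arg_max:
  assumes R: "R \<in> fmeasurable lborel" and \<nu>: "\<nu> \<in> \<Lambda>"
    and half: "measure lborel R \<le> 2 * measure lborel (R \<inter> V \<nu>)"
    and d: "is_arg_max (\<lambda>\<mu>. measure lborel (R \<inter> V \<mu>)) (\<lambda>\<mu>. \<mu> \<in> \<Lambda>) d"
  shows "measure lborel (R - V d) = measure lborel (R - V \<nu>)"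
proof (cases "d = \<nu>")
  case False
  have fm: "R \<inter> V \<mu> \<in> fmeasurable lborel" "R - V \<mu> \<in> fmeasurable lborel" for \<mu>
    using R voronoi_borel[of \<mu>] by (auto intro: fmeasurable_Int_fmeasurable fmeasurable_Diff)
  have diff: "measure lborel (R - V \<mu>) = measure lborel R - measure lborel (R \<inter> V \<mu>)" for \<mu>
    using measure_Un_AE[of "R \<inter> V \<mu>" "R - V \<mu>" lborel] fm[of \<mu>] by (simp add: Int_Diff_Un)
  \<comment> \<open>Off the null overlap, \<open>R \<inter> V d\<close> lies in
    \<open>R - V \<nu>\<close>, which by \<open>half\<close> is no larger than
    \<open>R \<inter> V \<nu>\<close>.\<close>
  have "measure lborel (R \<inter> V d) \<le> measure lborel ((R - V \<nu>) \<union> (V d \<inter> V \<nu>))"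
    using fm voronoi_Int_null[OF False]
    by (intro measure_mono_fmeasurable fmeasurableD[OF fm(1)]
        fmeasurable.Un[OF fm(2) fmeasurableI_null_sets]) blast+
  also have "\<dots> = measure lborel (R - V \<nu>)"
    using fmeasurableD[OF fm(2)] voronoi_Int_null[OF False] by (rule measure_Un_null_set)
  finally have "measure lborel (R \<inter> V d) \<le> measure lborel (R \<inter> V \<nu>)"
    using half unfolding diff by simp
  moreover have "measure lborel (R \<inter> V \<nu>) \<le> measure lborel (R \<inter> V d)"
    using d \<nu> unfolding is_arg_max_def by (meson not_less)
  ultimately show ?thesis unfolding diff by simp
qed simp

text \<open>The slope of \<open>uu\<close> on segment \<open>j\<close>. As \<open>ll\<close> is the
  point reflection of \<open>uu\<close>, its slope there is \<open>slope (- j)\<close>.\<close>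

definition slope :: "int \<Rightarrow> real" where
  "slope j = (if j = -2 then (1 - c) / s else if j > 0 then - c / s else 0)"

lemma uu_eq_line:
  assumes "j \<in> {-2..2}" "x \<in> {seg_lo \<rho> \<theta> j..seg_hi \<rho> \<theta> j}" "m \<in> {seg_lo \<rho> \<theta> j..seg_hi \<rho> \<theta> j}"
  shows "uu x = uu m + slope j * (x - m)"
proof -
  consider "j = -2" | "j = -1 \<or> j = 0" | "j = 1 \<or> j = 2" using assms(1) by fastforce
  then show ?thesis
  proof cases
    case 1
    then show ?thesis using assms uu_left[of x] uu_left[of m] s_pos
      by (simp add: seg_simps slope_def) (simp add: field_simps)
  next
    case 2
    then show ?thesis using assms uu_mid[of x] uu_mid[of m] c_pos c_less
      by (auto simp: seg_simps slope_def)
  next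
    case 3
    then show ?thesis using assms uu_right[of x] uu_right[of m] s_pos c_less
      by (auto simp: seg_simps slope_def field_simps)
  qed
qed

lemma ll_eq_line:
  assumes "j \<in> {-2..2}" "x \<in> {seg_lo \<rho> \<theta> j..seg_hi \<rho> \<theta> j}" "m \<in> {seg_lo \<rho> \<theta> j..seg_hi \<rho> \<theta> j}"
  shows "ll x = ll m + slope (- j) * (x - m)"
proof -
  have "seg_lo \<rho> \<theta> (- j) = - seg_hi \<rho> \<theta> j" "seg_hi \<rho> \<theta> (- j) = - seg_lo \<rho> \<theta> j"
    using int_minus2_to_2_cases[OF assms(1)] by (auto simp: seg_simps field_simps)
  then show ?thesis using uu_eq_line[of "- j" "- x" "- m"] assms
    by (simp add: ll_def algebra_simps)
qed

lemma slope_signs: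
  "j < 0 \<Longrightarrow> 0 \<le> slope j" "j < 0 \<Longrightarrow> slope (- j) \<le> 0"
  "0 \<le> j \<Longrightarrow> slope j \<le> 0" "0 \<le> j \<Longrightarrow> 0 \<le> slope (- j)"
  using c_pos c_less s_pos by (auto simp: slope_def)

text \<open>The lattice point decoded from a reply \<open>v\<close> in segment \<open>j\<close>. Where the corresponding
  rectangle is empty (\<open>v = 1\<close> for \<open>j = -1, 0\<close> and \<open>v = -1\<close> for \<open>j = 0, 1\<close>) the value is
  arbitrary.\<close>

definition decoded :: "int \<Rightarrow> int \<Rightarrow> real \<times> real" where
  "decoded j v = (if v = 0 then (0, 0)
     else if v = 1 then (if j < 0 then (c - 1, s) else (c, s))
     else (if j \<le> 0 then - (c, s) else - (c - 1, s)))"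

lemma decoded_in_lattice: "decoded j v \<in> \<Lambda>"
  unfolding decoded_def using relevant_in_lattice lattice_uminus by metis

lemma voronoi_decoded_upper:
  assumes "j \<in> {-2..2}" "x \<in> {seg_lo \<rho> \<theta> j..seg_hi \<rho> \<theta> j}" "m \<in> {seg_lo \<rho> \<theta> j..seg_hi \<rho> \<theta> j}"
    and y: "-(s/2) \<le> y" "y \<le> s/2" "uu m < y"
  shows "(x, y) \<in> V (decoded j 1) \<longleftrightarrow> uu x \<le> y"
proof -
  consider "j = -2" | "j = -1 \<or> j = 0" | "j = 1 \<or> j = 2" using assms(1) by fastforce
  then show ?thesis
  proof cases
    case 1
    then show ?thesis using assms voronoi_upper_left[of x y] by (simp add: seg_simps decoded_def)
  next
    case 2
    \<comment> \<open>Vacuous: \<open>uu m\<close> is the top edge \<open>s/2\<close>, so no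
      \<open>y\<close> of the cell lies above it.\<close>
    then show ?thesis using assms uu_mid[of m] c_pos c_less by (auto simp: seg_simps field_simps)
  next
    case 3
    then show ?thesis using assms voronoi_upper_right[of x y] c_pos c_less
      by (auto simp: seg_simps decoded_def)
  qed
qed

lemma voronoi_decoded_lower:
  assumes "j \<in> {-2..2}" "x \<in> {seg_lo \<rho> \<theta> j..seg_hi \<rho> \<theta> j}" "m \<in> {seg_lo \<rho> \<theta> j..seg_hi \<rho> \<theta> j}"
    and y: "-(s/2) \<le> y" "y \<le> s/2" "y < ll m"
  shows "(x, y) \<in> V (decoded j (-1)) \<longleftrightarrow> y \<le> ll x"
proof -
  have seg: "seg_lo \<rho> \<theta> (- j) = - seg_hi \<rho> \<theta> j" "seg_hi \<rho> \<theta> (- j) = - seg_lo \<rho> \<theta> j"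
    using int_minus2_to_2_cases[OF assms(1)] by (auto simp: seg_simps field_simps)
  have "decoded j (-1) = - decoded (- j) 1" by (simp add: decoded_def)
  then show ?thesis
    using voronoi_decoded_upper[of "- j" "- x" "- m" "- y"] assms
    by (simp add: voronoi_uminus ll_def seg) linarith
qed

lemma voronoi_decoded_middle:
  assumes "\<bar>x\<bar> \<le> 1/2" "-(s/2) \<le> y" "y \<le> s/2"
  shows "(x, y) \<in> V (decoded j 0) \<longleftrightarrow> ll x \<le> y \<and> y \<le> uu x"
  using voronoi_0_iff[OF assms] by (simp add: decoded_def)

end

section \<open>Decisions and error area inside one bin\<close>

context babai_bins begin

lemma rectangle_fmeasurable:
  assumes "i \<in> bins" "v \<in> {-1, 0, 1}"
  shows "rectangle \<rho> \<theta> N1 N2 i v \<in> fmeasurable lborel"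
proof (rule fmeasurableI2)
  show "cbox (blo i, -(s/2)) (bhi i, s/2) \<in> fmeasurable lborel" by (rule fmeasurable_cbox)
  show "rectangle \<rho> \<theta> N1 N2 i v \<subseteq> cbox (blo i, -(s/2)) (bhi i, s/2)"
    unfolding rectangle_eq[OF assms] by (auto simp: reply_interval_def cbox_Pair_eq)
  show "rectangle \<rho> \<theta> N1 N2 i v \<in> sets lborel"
    unfolding rectangle_eq[OF assms] by (auto intro!: borel_Times simp del: split_paired_All simp: reply_interval_borel)
qed

text \<open>The boundaries are monotone on a segment, so one of the two halves of a rectangle cut at the
  midpoint of the bin contains no errors.\<close>

lemma half_rectangle_in_voronoi:
  assumes "(j, k) \<in> bins" "v \<in> {-1, 0, 1}" and y: "y \<in> reply_interval (bmid (j, k)) v"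
    and x: "x \<in> {blo (j, k)<..bhi (j, k)}" "if (v = 0) = (j < 0) then bmid (j, k) \<le> x else x \<le> bmid (j, k)"
  shows "(x, y) \<in> V (decoded j v)"
proof -
  let ?m = "bmid (j, k)"
  have j: "j \<in> {-2..2}" using assms by (simp add: bins_iff)
  have seg: "x \<in> {seg_lo \<rho> \<theta> j..seg_hi \<rho> \<theta> j}" "?m \<in> {seg_lo \<rho> \<theta> j..seg_hi \<rho> \<theta> j}"
    using bin_subset_seg[OF assms(1)] bin_bounds[OF assms(1)] x by auto
  have x2: "\<bar>x\<bar> \<le> 1/2" using bin_bounds[OF assms(1)] x by auto
  note u = uu_eq_line[OF j seg] and l = ll_eq_line[OF j seg]
  consider "v = 0" | "v = 1" | "v = -1" using assms(2) by auto
  then show ?thesis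
  proof cases
    case 1
    have "0 \<le> slope j * (x - ?m)" "slope (- j) * (x - ?m) \<le> 0"
      using x(2) 1 slope_signs[of j]
      by (cases "j < 0"; simp add: mult_nonneg_nonneg mult_nonpos_nonpos mult_nonpos_nonneg mult_nonneg_nonpos)+
    then show ?thesis using 1 y voronoi_decoded_middle[OF x2, of y] u l by (simp add: reply_interval_def)
  next
    case 2
    have "slope j * (x - ?m) \<le> 0"
      using x(2) 2 slope_signs[of j]
      by (cases "j < 0"; simp add: mult_nonneg_nonneg mult_nonpos_nonpos mult_nonpos_nonneg mult_nonneg_nonpos)
    then show ?thesis using 2 y voronoi_decoded_upper[OF j seg, of y] u by (simp add: reply_interval_def)
  next
    case 3
    have "0 \<le> slope (- j) * (x - ?m)"
      using x(2) 3 slope_signs[of j]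
      by (cases "j < 0"; simp add: mult_nonneg_nonneg mult_nonpos_nonpos mult_nonpos_nonneg mult_nonneg_nonpos)
    then show ?thesis using 3 y voronoi_decoded_lower[OF j seg, of y] l by (simp add: reply_interval_def)
  qed
qed

lemma decoded_covers_half:
  assumes "(j, k) \<in> bins" "v \<in> {-1, 0, 1}"
  defines "R \<equiv> rectangle \<rho> \<theta> N1 N2 (j, k) v"
  shows "measure lborel R \<le> 2 * measure lborel (R \<inter> V (decoded j v))"
proof -
  let ?J = "reply_interval (bmid (j, k)) v"
  \<comment> \<open>The error-free half. For \<open>j < 0\<close>, moving right raises
    \<open>uu\<close> and lowers \<open>ll\<close> (weakly), so the right half is safe for reply 0
    and the left half for replies 1 and -1; for \<open>j \<ge> 0\<close> the sides are
    exchanged.\<close>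
  define H where "H = (if (v = 0) = (j < 0) then {bmid (j, k)<..bhi (j, k)} else {blo (j, k)<..bmid (j, k)})"
  have j: "j \<in> {-2..2}" using assms by (simp add: bins_iff)
  have w: "measure lborel H = width j / 2" "measure lborel {blo (j, k)<..bhi (j, k)} = width j"
    using width_pos[OF j] unfolding H_def bin_mid_eq by simp_all
  have R: "R = {blo (j, k)<..bhi (j, k)} \<times> ?J" unfolding R_def by (rule rectangle_eq[OF assms(1,2)])
  have "measure lborel R = 2 * measure lborel (H \<times> ?J)"
    unfolding R by (subst (1 2) measure_lborel_Times) (simp_all add: w reply_interval_borel, simp add: H_def)
  also have "measure lborel (H \<times> ?J) \<le> measure lborel (R \<inter> V (decoded j v))"
  proof (rule measure_mono_fmeasurable)
    show "R \<inter> V (decoded j v) \<in> fmeasurable lborel"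
      unfolding R_def by (intro fmeasurable_Int_fmeasurable rectangle_fmeasurable assms(1,2))
        (simp add: voronoi_borel)
    show "H \<times> ?J \<in> sets lborel"
      using reply_interval_borel[of "bmid (j, k)" v] by (auto simp: H_def intro!: borel_Times)
    show "H \<times> ?J \<subseteq> R \<inter> V (decoded j v)"
    proof clarify
      fix x y assume x: "x \<in> H" and y: "y \<in> ?J"
      then have "x \<in> {blo (j, k)<..bhi (j, k)}"
        "if (v = 0) = (j < 0) then bmid (j, k) \<le> x else x \<le> bmid (j, k)"
        using bin_bounds[OF assms(1)] by (auto simp: H_def split: if_splits)
      from half_rectangle_in_voronoi[OF assms(1,2) y this] y this(1)
      show "(x, y) \<in> R \<inter> V (decoded j v)" by (simp add: R)
    qed
  qed
  finally show ?thesis by simp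
qed

text \<open>The error set under the reference decision \<open>decoded\<close>;
  \<open>error_prob_eq_sum\<close> shows that every admissible decision rule has the same total
  error area.\<close>

definition bin_error :: "int \<times> nat \<Rightarrow> (real \<times> real) set" where
  "bin_error i = (\<Union>v\<in>{-1, 0, 1}. rectangle \<rho> \<theta> N1 N2 i v - V (decoded (fst i) v))"

lemma bin_error_borel: "i \<in> bins \<Longrightarrow> bin_error i \<in> sets borel"
  unfolding bin_error_def
  using rectangle_fmeasurable voronoi_borel
  by (intro sets.finite_UN sets.Diff) (auto simp: fmeasurable_def)

lemma bin_error_slice:
  assumes i: "(j, k) \<in> bins" and x: "x \<in> {blo (j, k)<..<bhi (j, k)}"
  defines "m \<equiv> bmid (j, k)"
  shows "emeasure lborel {y. (x, y) \<in> bin_error (j, k)} = ennreal ((\<bar>slope j\<bar> + \<bar>slope (- j)\<bar>) * \<bar>x - m\<bar>)"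
proof -
  have j: "j \<in> {-2..2}" using assms by (simp add: bins_iff)
  have seg: "x \<in> {seg_lo \<rho> \<theta> j..seg_hi \<rho> \<theta> j}" "m \<in> {seg_lo \<rho> \<theta> j..seg_hi \<rho> \<theta> j}"
    using bin_subset_seg[OF i] bin_bounds[OF i] x by (auto simp: m_def)
  have x2: "\<bar>x\<bar> \<le> 1/2" and m2: "\<bar>m\<bar> \<le> 1/2" using bin_bounds[OF i] x by (auto simp: m_def)
  have pos: "0 < uu x" "0 < uu m" "ll x < 0" "ll m < 0"
    using uu_pos ll_neg x2 m2 by auto
  let ?S = "{y. (x, y) \<in> bin_error (j, k)}"
  have S: "y \<in> ?S \<longleftrightarrow> -(s/2) < y \<and> y \<le> s/2 \<and>
     (uu m < y \<and> y < uu x \<or> y < ll m \<and> ll x < y \<or> ll m \<le> y \<and> y \<le> uu m \<and> \<not> (ll x \<le> y \<and> y \<le> uu x))" for y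
    using x i pos voronoi_decoded_upper[OF j seg, of y] voronoi_decoded_lower[OF j seg, of y]
      voronoi_decoded_middle[OF x2, of y j]
    by (auto simp: bin_error_def rectangle_eq reply_interval_def m_def[symmetric])
  let ?u = "min (uu x) (uu m)" and ?U = "max (uu x) (uu m)" and ?l = "min (ll x) (ll m)" and ?L = "max (ll x) (ll m)"
  \<comment> \<open>Which endpoints of the two gaps belong to \<open>?S\<close> depends on the order
    of the boundary values at \<open>x\<close> and \<open>m\<close>. Sandwiching between open and
    closed intervals avoids this distinction.\<close>
  have low: "{?l<..<?L} \<union> {?u<..<?U} \<subseteq> ?S"
    using pos uu_le[of x] uu_le[of m] ll_ge[of x] ll_ge[of m] unfolding S subset_iff by (auto simp: min_def max_def split: if_splits)
  have up: "?S \<subseteq> {?l..?L} \<union> {?u..?U}"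
    using pos unfolding S subset_iff by auto
  have Sb: "?S \<in> sets borel"
    using measurable_sets_borel[OF _ bin_error_borel[OF i], of "Pair x"] by (simp add: vimage_def)
  have e: "ennreal (?L - ?l) + ennreal (?U - ?u) = ennreal ((\<bar>slope j\<bar> + \<bar>slope (- j)\<bar>) * \<bar>x - m\<bar>)"
  proof -
    have "?L - ?l = \<bar>ll x - ll m\<bar>" "?U - ?u = \<bar>uu x - uu m\<bar>" by auto
    then show ?thesis
      unfolding uu_eq_line[OF j seg] ll_eq_line[OF j seg]
      by (simp add: abs_mult ennreal_plus[symmetric] distrib_right del: ennreal_plus)
  qed
  \<comment> \<open>One gap lies below the horizontal axis and the other above it, so they are
    disjoint and their lengths add.\<close>
  have "emeasure lborel ({?l<..<?L} \<union> {?u<..<?U}) = ennreal (?L - ?l) + ennreal (?U - ?u)"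
    using pos by (subst plus_emeasure[symmetric]) auto
  with emeasure_mono[OF low, of lborel] Sb e
  have "ennreal ((\<bar>slope j\<bar> + \<bar>slope (- j)\<bar>) * \<bar>x - m\<bar>) \<le> emeasure lborel ?S" by simp
  moreover have "emeasure lborel ({?l..?L} \<union> {?u..?U}) = ennreal (?L - ?l) + ennreal (?U - ?u)"
    using pos by (subst plus_emeasure[symmetric]) auto
  with emeasure_mono[OF up, of lborel] e
  have "emeasure lborel ?S \<le> ennreal ((\<bar>slope j\<bar> + \<bar>slope (- j)\<bar>) * \<bar>x - m\<bar>)" by simp
  ultimately show ?thesis by simp
qed

lemma measure_bin_error:
  assumes i: "(j, k) \<in> bins"
  shows "measure lborel (bin_error (j, k)) = (\<bar>slope j\<bar> + \<bar>slope (- j)\<bar>) * (width j)\<^sup>2 / 4"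
proof -
  have j: "j \<in> {-2..2}" using assms by (simp add: bins_iff)
  have "((\<lambda>x. (\<bar>slope j\<bar> + \<bar>slope (- j)\<bar>) * \<bar>x - bmid (j, k)\<bar>) has_integral
      (\<bar>slope j\<bar> + \<bar>slope (- j)\<bar>) * (width j / 2)\<^sup>2) {blo (j, k)..bhi (j, k)}"
    unfolding bin_mid_eq using width_pos[OF j]
    by (intro has_integral_mult_right has_integral_abs_symmetric) simp
  then have "emeasure lborel (bin_error (j, k)) = ennreal ((\<bar>slope j\<bar> + \<bar>slope (- j)\<bar>) * (width j / 2)\<^sup>2)"
    using bin_error_slice[OF i] bin_error_borel[OF i]
    by (intro area_slices) (auto simp: bin_error_def rectangle_eq i)
  then show ?thesis by (simp add: measure_def power_divide)
qed

end

section \<open>Midpoint sums and continuity of the entropy summand\<close>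

text \<open>The step \<open>h\<close> is a parameter independent of \<open>n\<close>, so that the
  induction appends one cell and leaves the earlier ones unchanged.\<close>

lemma midpoint_sum_error:
  fixes f :: "real \<Rightarrow> real"
  assumes f: "continuous_on {a..a + real n * h} f" and h: "0 \<le> h"
    and osc: "\<And>k x. k < n \<Longrightarrow> x \<in> {a + real k * h..a + (real k + 1) * h} \<Longrightarrow>
      \<bar>f x - f (a + (real k + 1/2) * h)\<bar> \<le> e"
  shows "\<bar>integral {a..a + real n * h} f - h * (\<Sum>k<n. f (a + (real k + 1/2) * h))\<bar> \<le> e * (real n * h)"
  using f osc
proof (induction n)
  case (Suc n)
  let ?p = "a + real n * h" and ?q = "a + real (Suc n) * h" and ?m = "a + (real n + 1/2) * h"
  have pq: "?q = ?p + h" "a \<le> ?p" "?p \<le> ?q" using h by (simp_all add: algebra_simps)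
  have int: "f integrable_on {a..?q}" using Suc.prems(1) by (rule integrable_continuous_real)
  have cont: "continuous_on {a..?p} f" "continuous_on {?p..?q} f"
    by (rule continuous_on_subset[OF Suc.prems(1)], unfold atLeastatMost_subset_iff, use pq in linarith)+
  have IH: "\<bar>integral {a..?p} f - h * (\<Sum>k<n. f (a + (real k + 1/2) * h))\<bar> \<le> e * (real n * h)"
    using Suc.IH[OF cont(1)] Suc.prems(2) by simp
  have split: "integral {a..?q} f = integral {a..?p} f + integral {?p..?q} f"
    using Henstock_Kurzweil_Integration.integral_combine[OF pq(2,3) int] by simp
  have "integral {?p..?q} (\<lambda>x. f x - f ?m) = integral {?p..?q} f - integral {?p..?q} (\<lambda>x. f ?m)"
    by (intro Henstock_Kurzweil_Integration.integral_diff integrable_continuous_real cont continuous_intros)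
  moreover have "norm (integral {?p..?q} (\<lambda>x. f x - f ?m)) \<le> e * (?q - ?p)"
  proof (rule integral_bound[OF pq(3)])
    show "continuous_on {?p..?q} (\<lambda>x. f x - f ?m)" by (intro continuous_intros cont)
    show "norm (f x - f ?m) \<le> e" if "x \<in> {?p..?q}" for x
      using Suc.prems(2)[of n x] that by (simp add: add.commute)
  qed
  ultimately have "\<bar>integral {?p..?q} f - h * f ?m\<bar> \<le> e * h"
    using pq h by simp
  then show ?case using IH unfolding split by (simp add: algebra_simps abs_le_iff)
qed simp

lemma midpoint_sum_tendsto:
  fixes f :: "real \<Rightarrow> real"
  assumes f: "continuous_on {a..b} f" and ab: "a < b"
  shows "(\<lambda>N. (b - a) / real N * (\<Sum>k<N. f (a + (real k + 1/2) * ((b - a) / real N))))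
    \<longlonglongrightarrow> integral {a..b} f"
proof (rule LIMSEQ_I)
  fix r :: real assume r: "0 < r"
  define e where "e = r / (2 * (b - a))"
  have e: "0 < e" using r ab by (simp add: e_def)
  have "uniformly_continuous_on {a..b} f" using f by (intro compact_uniformly_continuous) auto
  then obtain d where d: "0 < d"
    "\<And>x y. x \<in> {a..b} \<Longrightarrow> y \<in> {a..b} \<Longrightarrow> dist y x < d \<Longrightarrow> dist (f y) (f x) < e"
    unfolding uniformly_continuous_on_def using e by blast
  obtain n where n: "(b - a) / d < real n" using reals_Archimedean2 by blast
  show "\<exists>n0. \<forall>N\<ge>n0. norm ((b - a) / real N * (\<Sum>k<N. f (a + (real k + 1/2) * ((b - a) / real N)))
      - integral {a..b} f) < r"
  proof (intro exI allI impI)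
    fix N assume N: "n \<le> N"
    have "0 < (b - a) / d" using ab d by simp
    then have N0: "(b - a) / d < real N" "0 < real N" using n N by linarith+
    define h where "h = (b - a) / real N"
    have h: "0 < h" "h < d" "real N * h = b - a"
      using N0 ab d by (simp_all add: h_def field_simps)
    have "\<bar>integral {a..a + real N * h} f - h * (\<Sum>k<N. f (a + (real k + 1/2) * h))\<bar> \<le> e * (real N * h)"
    proof (rule midpoint_sum_error)
      show "continuous_on {a..a + real N * h} f" using f h by simp
      fix k x assume k: "k < N" and x: "x \<in> {a + real k * h..a + (real k + 1) * h}"
      have "(real k + 1) * h \<le> real N * h" using k h by (intro mult_right_mono) auto
      moreover have "0 \<le> real k * h" using h by simp
      moreover have "(real k + 1) * h = real k * h + h" "(real k + 1/2) * h = real k * h + h / 2"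
        by (simp_all add: algebra_simps)
      ultimately have "x \<in> {a..b}" "a + (real k + 1/2) * h \<in> {a..b}"
        "dist x (a + (real k + 1/2) * h) < d"
        using x h unfolding atLeastAtMost_iff dist_real_def abs_less_iff by linarith+
      then show "\<bar>f x - f (a + (real k + 1/2) * h)\<bar> \<le> e"
        using d(2) unfolding dist_real_def by (meson less_imp_le)
    qed (use h in simp)
    also have "e * (real N * h) = r / 2" using ab unfolding h(3) e_def by (simp add: divide_simps)
    also have "\<dots> < r" using r by simp
    finally show "norm ((b - a) / real N * (\<Sum>k<N. f (a + (real k + 1/2) * ((b - a) / real N)))
      - integral {a..b} f) < r"
      using h by (simp add: h_def[symmetric] abs_minus_commute)
  qed
qed

text \<open>The point 0 matters because reply probabilities vanish wherever a boundary runs along an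
  edge of the Babai cell. There, substituting \<open>1 / t\<close> turns the limit into that of
  \<open>ln u / u\<close> at infinity.\<close>

lemma continuous_on_x_log_x: "continuous_on {0..} (\<lambda>t::real. t * log 2 t)"
proof -
  have "((\<lambda>t::real. ln (inverse t) / inverse t) \<longlongrightarrow> 0) (at_right 0)"
    by (rule filterlim_compose[OF ln_x_over_x_tendsto_0 filterlim_inverse_at_top_right])
  then have "((\<lambda>t::real. (- 1 / ln 2) * (ln (inverse t) / inverse t)) \<longlongrightarrow> (- 1 / ln 2) * 0) (at_right 0)"
    by (intro tendsto_intros)
  then have "((\<lambda>t::real. t * log 2 t) \<longlongrightarrow> 0) (at_right 0)"
  proof (rule Lim_transform_eventually[THEN tendsto_eq_rhs])
    have "\<forall>\<^sub>F t::real in at_right 0. 0 < t" by (rule eventually_at_right_less)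
    then show "\<forall>\<^sub>F t::real in at_right 0. (- 1 / ln 2) * (ln (inverse t) / inverse t) = t * log 2 t"
      by eventually_elim (simp add: ln_inverse log_def divide_inverse)
  qed simp
  then have "continuous (at 0 within {0..}) (\<lambda>t::real. t * log 2 t)"
    by (simp add: continuous_within at_within_Ici_at_right)
  moreover have "continuous (at t within {0..}) (\<lambda>t::real. t * log 2 t)" if "0 < t" for t
    using that by (intro continuous_intros) auto
  ultimately show ?thesis
    unfolding continuous_on_eq_continuous_within by (metis atLeast_iff order_le_less)
qed

section \<open>Message probabilities and entropies\<close>

context babai begin

lemma B_eq: "B = {-(1/2)<..1/2} \<times> {-(s/2)<..s/2}"
  by (simp add: babai_cell_def s_def)

lemma measure_B: "measure lborel B = s" "emeasure lborel B = ennreal s"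
proof -
  show m: "measure lborel B = s" using s_pos unfolding B_eq by (simp add: measure_lborel_Times)
  have "emeasure lborel B \<noteq> \<infinity>"
    using s_pos unfolding B_eq lborel_prod[symmetric]
    by (subst lborel.emeasure_pair_measure_Times) (auto simp: ennreal_mult_eq_top_iff)
  then show "emeasure lborel B = ennreal s" by (simp add: emeasure_eq_ennreal_measure m)
qed

text \<open>The entries of \<open>Q(x)\<close> in closed form: lengths of the three vertical pieces
  divided by the height \<open>s\<close> of the cell.\<close>

definition reply_prob :: "real \<Rightarrow> int \<Rightarrow> real" where
  "reply_prob x v = (if v = 1 then s/2 - uu x else if v = 0 then uu x - ll x else ll x + s/2) / s"

lemma measure_reply_interval:
  assumes "\<bar>x\<bar> \<le> 1/2"
  shows "measure lborel (reply_interval x v) = s * reply_prob x v"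
proof -
  have ord: "-(s/2) \<le> ll x" "ll x < 0" "0 < uu x" "uu x \<le> s/2"
    using uu_pos uu_le ll_neg ll_ge assms by auto
  consider "v = 1" | "v = 0" | "v \<noteq> 0" "v \<noteq> 1" by blast
  then show ?thesis
  proof cases
    case 1
    then have "reply_interval x v = {uu x<..s/2}" using ord by (auto simp: reply_interval_def)
    then show ?thesis using 1 ord s_pos by (simp add: reply_prob_def)
  next
    case 2
    \<comment> \<open>The lower edge does not belong to the Babai cell, so the endpoint
      \<open>ll x\<close> is lost when it lies on that edge.\<close>
    then have "reply_interval x v = (if ll x = -(s/2) then {ll x<..uu x} else {ll x..uu x})"
      using ord by (auto simp: reply_interval_def)
    then show ?thesis using 2 ord s_pos by (simp add: reply_prob_def)
  next
    case 3
    then have "reply_interval x v = {-(s/2)<..<ll x}" using ord by (auto simp: reply_interval_def)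
    then show ?thesis using 3 ord s_pos by (simp add: reply_prob_def)
  qed
qed

lemma reply_prob_nonneg: "\<bar>x\<bar> \<le> 1/2 \<Longrightarrow> 0 \<le> reply_prob x v"
  using measure_reply_interval[of x v] s_pos by (metis measure_nonneg zero_le_mult_iff not_less)

end

section \<open>The uniform source and the vector \<open>Q(x)\<close>\<close>

locale babai_source = babai \<rho> \<theta> + prob_space M for \<rho> \<theta> and M :: "'a measure" +
  fixes X :: "'a \<Rightarrow> real \<times> real"
  assumes X_measurable: "X \<in> borel_measurable M"
    and X_uniform: "distr M lborel X = uniform_measure lborel (babai_cell \<rho> \<theta>)"
begin

lemma prob_X:
  assumes "S \<in> sets borel"
  shows "measure M {\<omega> \<in> space M. X \<omega> \<in> S} = measure lborel (B \<inter> S) / s"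
proof -
  have "measure M {\<omega> \<in> space M. X \<omega> \<in> S} = measure (distr M lborel X) S"
    using X_measurable assms by (subst measure_distr) (auto simp: vimage_def Int_def conj_commute)
  also have "\<dots> = measure lborel (B \<inter> S) / s"
    unfolding X_uniform using assms s_pos by (subst measure_uniform_measure) (auto simp: measure_B)
  finally show ?thesis .
qed

lemma prob_snd:
  assumes "J \<in> sets borel"
  shows "measure M {\<omega> \<in> space M. snd (X \<omega>) \<in> J} = measure lborel ({-(s/2)<..s/2} \<inter> J) / s"
proof -
  have "UNIV \<times> J \<in> sets borel" using assms by (intro borel_Times) auto
  from prob_X[OF this] have "measure M {\<omega> \<in> space M. snd (X \<omega>) \<in> J} = measure lborel (B \<inter> UNIV \<times> J) / s"
    by (simp add: mem_Times_iff)
  also have "B \<inter> UNIV \<times> J = {-(1/2)<..1/2} \<times> ({-(s/2)<..s/2} \<inter> J)" by (auto simp: B_eq)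
  also have "measure lborel \<dots> = measure lborel ({-(s/2)<..s/2} \<inter> J)"
    using assms by (subst measure_lborel_Times) auto
  finally show ?thesis .
qed

lemma Q_vec_eq:
  assumes "-(1/2) < x" "x \<le> 1/2"
  shows "Q_vec \<rho> \<theta> M X x = [reply_prob x (-1), reply_prob x 0, reply_prob x 1]"
proof -
  have x: "\<bar>x\<bar> \<le> 1/2" using assms by simp
  have *: "measure M {\<omega> \<in> space M. snd (X \<omega>) \<in> J} = reply_prob x v"
    if "J \<in> sets borel" "reply_interval x v = {-(s/2)<..s/2} \<inter> J" for J v
    using prob_snd[OF that(1)] measure_reply_interval[OF x, of v] s_pos by (simp add: that(2))
  have "measure M {\<omega> \<in> space M. snd (X \<omega>) < ll x} = reply_prob x (-1)"
    "measure M {\<omega> \<in> space M. ll x \<le> snd (X \<omega>) \<and> snd (X \<omega>) \<le> uu x} = reply_prob x 0"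
    "measure M {\<omega> \<in> space M. snd (X \<omega>) > uu x} = reply_prob x 1"
    using *[of "{..<ll x}" "-1"] *[of "{ll x..uu x}" 0] *[of "{uu x<..}" 1]
    by (simp_all add: reply_interval_def)
  then show ?thesis unfolding Q_vec_def ends_eq[OF assms] by simp
qed

end

section \<open>Message events, their entropies and the total error area\<close>

locale babai_scheme = babai_source \<rho> \<theta> M X + babai_bins \<rho> \<theta> N1 N2
  for \<rho> \<theta> and M :: "'a measure" and X N1 N2
begin

abbreviation "u1 \<equiv> U1 \<rho> \<theta> N1 N2 X"
abbreviation "u2 \<equiv> U2 \<rho> \<theta> N1 N2 X"

text \<open>Message events as subsets of the whole plane: \<open>X\<close> lies in the Babai cell
  only almost surely, so the restriction to \<open>B\<close> enters with the probabilities.\<close>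

definition msg1_cell :: "int \<times> nat \<Rightarrow> (real \<times> real) set" where
  "msg1_cell i = {p. msg1 \<rho> \<theta> N1 N2 (fst p) = i}"
definition msg_cell :: "int \<times> nat \<Rightarrow> int \<Rightarrow> (real \<times> real) set" where
  "msg_cell i v = {p \<in> msg1_cell i. msg2 \<rho> \<theta> N1 N2 i (snd p) = v}"

lemma msg1_cell_borel: "msg1_cell i \<in> sets borel"
proof -
  have "(\<lambda>p. msg1 \<rho> \<theta> N1 N2 (fst p)) \<in> borel \<rightarrow>\<^sub>M count_space UNIV"
    by (rule measurable_compose[OF _ msg1_measurable]) (intro borel_measurable_continuous_onI continuous_intros)
  from measurable_sets[OF this, of "{i}"] show ?thesis by (simp add: msg1_cell_def vimage_def)
qed

lemma msg_cell_borel: "msg_cell i v \<in> sets borel"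
proof -
  let ?m = "bmid i"
  have "msg_cell i v = msg1_cell i \<inter> UNIV \<times>
      {y. (if y > u_end \<rho> \<theta> ?m then 1 else if y < l_end \<rho> \<theta> ?m then -1 else 0) = v}"
    by (auto simp: msg_cell_def msg2_def Let_def)
  also have "\<dots> \<in> sets borel"
    by (intro sets.Int msg1_cell_borel borel_Times) auto
  finally show ?thesis .
qed

lemma rectangle_eq_msg_cell: "rectangle \<rho> \<theta> N1 N2 i v = B \<inter> msg_cell i v"
  by (auto simp: rectangle_def msg_cell_def msg1_cell_def)

lemma U1_iff: "u1 \<omega> = i \<longleftrightarrow> X \<omega> \<in> msg1_cell i"
  by (simp add: U1_def msg1_cell_def)

lemma U1_U2_iff: "u1 \<omega> = i \<and> u2 \<omega> = v \<longleftrightarrow> X \<omega> \<in> msg_cell i v"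
  by (auto simp: U1_def U2_def msg1_cell_def msg_cell_def)

lemma prob_U1:
  "prob {\<omega> \<in> space M. u1 \<omega> = i} = (if i \<in> bins then width (fst i) else 0)"
proof (cases "i \<in> bins")
  case True
  have "B \<inter> msg1_cell i = {blo i<..bhi i} \<times> {-(s/2)<..s/2}"
  proof (intro set_eqI)
    fix p show "p \<in> B \<inter> msg1_cell i \<longleftrightarrow> p \<in> {blo i<..bhi i} \<times> {-(s/2)<..s/2}"
      using bin_bounds[OF True] msg1_eq_iff[OF _ _ True, of "fst p"]
      unfolding B_eq msg1_cell_def Int_iff mem_Times_iff by auto
  qed
  moreover have "blo i \<le> bhi i" "bhi i - blo i = width (fst i)"
    using bin_bounds[OF True] bin_mid_eq[of "fst i" "snd i"] by auto
  ultimately show ?thesis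
    using True s_pos prob_X[OF msg1_cell_borel, of i] by (simp add: U1_iff measure_lborel_Times)
next
  case False
  then have "B \<inter> msg1_cell i = {}" using msg1_in_bins by (auto simp: B_eq msg1_cell_def)
  then show ?thesis using False prob_X[OF msg1_cell_borel, of i] by (simp add: U1_iff)
qed

lemma prob_U1_U2:
  assumes "i \<in> bins" "v \<in> {-1, 0, 1}"
  shows "prob {\<omega> \<in> space M. u1 \<omega> = i \<and> u2 \<omega> = v} = width (fst i) * reply_prob (bmid i) v"
proof -
  have w: "blo i \<le> bhi i" "bhi i - blo i = width (fst i)"
    using bin_bounds[OF assms(1)] bin_mid_eq[of "fst i" "snd i"] by auto
  have "\<bar>bmid i\<bar> \<le> 1/2" using bin_bounds[OF assms(1)] by auto
  note J = measure_reply_interval[OF this, of v]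
  have "prob {\<omega> \<in> space M. u1 \<omega> = i \<and> u2 \<omega> = v} = measure lborel (rectangle \<rho> \<theta> N1 N2 i v) / s"
    unfolding U1_U2_iff rectangle_eq_msg_cell by (rule prob_X[OF msg_cell_borel])
  also have "measure lborel (rectangle \<rho> \<theta> N1 N2 i v) = width (fst i) * (s * reply_prob (bmid i) v)"
    unfolding rectangle_eq[OF assms]
    by (subst measure_lborel_Times) (simp_all add: reply_interval_borel J w)
  finally show ?thesis using s_pos by simp
qed

lemma prob_U1_U2_outside:
  assumes "i \<notin> bins"
  shows "prob {\<omega> \<in> space M. u1 \<omega> = i \<and> u2 \<omega> = v} = 0"
proof -
  have "B \<inter> msg_cell i v = {}" using assms msg1_in_bins by (auto simp: B_eq msg1_cell_def msg_cell_def)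
  then show ?thesis unfolding U1_U2_iff prob_X[OF msg_cell_borel] by simp
qed

lemma U2_range: "u2 \<omega> \<in> {-1, 0, 1}"
  by (auto simp: U2_def msg2_def Let_def)

lemma U1_range: "u1 ` space M \<subseteq> insert (THE i. False) bins"
proof (rule image_subsetI)
  fix \<omega>
  show "u1 \<omega> \<in> insert (THE i. False) bins"
    using msg1_in_bins[of "fst (X \<omega>)"] msg1_outside[of "fst (X \<omega>)"] unfolding U1_def by blast
qed

lemma simple_U1: "simple_function M u1"
  unfolding simple_function_def
proof (intro conjI ballI)
  show "finite (u1 ` space M)" using U1_range finite_bins by (auto intro: finite_subset)
  show "u1 -` {i} \<inter> space M \<in> events" for i
  proof -
    have "u1 -` {i} \<inter> space M = X -` msg1_cell i \<inter> space M" by (simp add: set_eq_iff U1_iff)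
    then show ?thesis using measurable_sets[OF X_measurable msg1_cell_borel] by simp
  qed
qed

lemma simple_U2_U1: "simple_function M (\<lambda>\<omega>. (u2 \<omega>, u1 \<omega>))"
  unfolding simple_function_def
proof (intro conjI ballI)
  have "(\<lambda>\<omega>. (u2 \<omega>, u1 \<omega>)) ` space M \<subseteq> {-1, 0, 1} \<times> insert (THE i. False) bins"
    using U1_range U2_range by (auto simp del: insert_iff)
  then show "finite ((\<lambda>\<omega>. (u2 \<omega>, u1 \<omega>)) ` space M)" using finite_bins by (auto intro: finite_subset)
  show "(\<lambda>\<omega>. (u2 \<omega>, u1 \<omega>)) -` {z} \<inter> space M \<in> events" for z
  proof -
    obtain v i where z: "z = (v, i)" by (cases z)
    have "(\<lambda>\<omega>. (u2 \<omega>, u1 \<omega>)) -` {(v, i)} \<inter> space M = X -` msg_cell i v \<inter> space M" by (simp add: set_eq_iff z U1_U2_iff[symmetric] conj_ac)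
    then show ?thesis using measurable_sets[OF X_measurable msg_cell_borel] by (simp add: z)
  qed
qed

sublocale information_space M 2 by standard simp

text \<open>The exact range of \<open>u1\<close> is not known: it may contain the fallback index.
  The sum passes through the union of range and bins, where only terms of probability zero are added
  or dropped.\<close>

lemma bits_U1: "bits M u1 = - (\<Sum>i\<in>bins. width (fst i) * log 2 (width (fst i)))"
proof -
  let ?p = "\<lambda>i. prob (u1 -` {i} \<inter> space M)"
  have p: "?p i = (if i \<in> bins then width (fst i) else 0)" for i
    using prob_U1[of i] by (simp add: vimage_def Int_def conj_commute)
  have "bits M u1 = - (\<Sum>i\<in>u1 ` space M. ?p i * log 2 (?p i))"
    unfolding bits_def by (rule entropy_simple_distributed[OF simple_distributedI[OF simple_U1]]) auto
  also have "(\<Sum>i\<in>u1 ` space M. ?p i * log 2 (?p i)) = (\<Sum>i\<in>u1 ` space M \<union> bins. ?p i * log 2 (?p i))"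
  proof (rule sum.mono_neutral_left)
    show "\<forall>i\<in>u1 ` space M \<union> bins - u1 ` space M. ?p i * log 2 (?p i) = 0"
    proof
      fix i assume "i \<in> u1 ` space M \<union> bins - u1 ` space M"
      then have "u1 -` {i} \<inter> space M = {}" by blast
      then show "?p i * log 2 (?p i) = 0" by simp
    qed
  qed (use simple_functionD[OF simple_U1] finite_bins in auto)
  also have "\<dots> = (\<Sum>i\<in>bins. ?p i * log 2 (?p i))"
    using simple_functionD[OF simple_U1] finite_bins by (intro sum.mono_neutral_right) (auto simp: p)
  also have "\<dots> = (\<Sum>i\<in>bins. width (fst i) * log 2 (width (fst i)))"
    by (intro sum.cong) (auto simp: p)
  finally show ?thesis .
qed

text \<open>The two coordinates of a uniform point of a box are independent, so given bin
  \<open>i\<close> the reply has law \<open>Q\<close> at the midpoint of that bin.\<close>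

lemma cond_bits_U2_U1:
  "cond_bits M u2 u1 = (\<Sum>i\<in>bins. width (fst i) * vec_entropy (Q_vec \<rho> \<theta> M X (bmid i)))"
proof -
  let ?P = "(\<lambda>\<omega>. (u2 \<omega>, u1 \<omega>))" and ?q = "\<lambda>i. prob (u1 -` {i} \<inter> space M)"
  let ?p = "\<lambda>z. prob (?P -` {z} \<inter> space M)"
  let ?A = "{-1, 0, 1} \<times> bins"
  let ?f = "\<lambda>z. ?p z * log 2 (?p z / ?q (snd z))"
  have q: "?q i = (if i \<in> bins then width (fst i) else 0)" for i
    using prob_U1[of i] by (simp add: vimage_def Int_def conj_commute)
  have p_eq: "?p (v, i) = prob {\<omega> \<in> space M. u1 \<omega> = i \<and> u2 \<omega> = v}" for v i
    by (rule arg_cong[where f = prob]) auto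
  have fin: "finite (?P ` space M)" "finite ?A"
    using simple_functionD[OF simple_U2_U1] finite_bins by auto
  have "cond_bits M u2 u1 = - (\<Sum>(v, i)\<in>?P ` space M. ?p (v, i) * log 2 (?p (v, i) / ?q i))"
    unfolding cond_bits_def
    by (rule conditional_entropy_eq; rule simple_distributedI; (rule simple_U1 simple_U2_U1)?) auto
  also have "(\<Sum>(v, i)\<in>?P ` space M. ?p (v, i) * log 2 (?p (v, i) / ?q i)) = sum ?f (?P ` space M)"
    by (intro sum.cong) auto
  also have "\<dots> = sum ?f (?P ` space M \<union> ?A)"
  proof (rule sum.mono_neutral_left)
    show "\<forall>z\<in>?P ` space M \<union> ?A - ?P ` space M. ?f z = 0"
    proof
      fix z assume "z \<in> ?P ` space M \<union> ?A - ?P ` space M"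
      then have "?P -` {z} \<inter> space M = {}" by auto
      then show "?f z = 0" by (simp only: measure_empty mult_zero_left)
    qed
  qed (use fin in auto)
  also have "\<dots> = sum ?f ?A"
  proof (rule sum.mono_neutral_right)
    show "\<forall>z\<in>?P ` space M \<union> ?A - ?A. ?f z = 0"
    proof
      fix z assume z: "z \<in> ?P ` space M \<union> ?A - ?A"
      obtain v i where vi: "z = (v, i)" by (cases z)
      have "v \<in> {-1, 0, 1}" using z U2_range unfolding vi by blast
      then have "i \<notin> bins" using z unfolding vi by blast
      then have "?p (v, i) = 0" unfolding p_eq by (rule prob_U1_U2_outside)
      then show "?f z = 0" by (simp only: vi mult_zero_left)
    qed
  qed (use fin in auto)
  also have "\<dots> = (\<Sum>i\<in>bins. \<Sum>v\<in>{-1, 0, 1}. ?f (v, i))"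
    unfolding sum.cartesian_product' by (rule sum.swap)
  also have "\<dots> = (\<Sum>i\<in>bins. - (width (fst i) * vec_entropy (Q_vec \<rho> \<theta> M X (bmid i))))"
  proof (rule sum.cong[OF refl])
    fix i assume i: "i \<in> bins"
    have w: "0 < width (fst i)" using i by (cases i) (auto simp: bins_iff intro!: width_pos)
    \<comment> \<open>The joint probability divided by the probability of the bin leaves
      \<open>reply_prob\<close>.\<close>
    have "?f (v, i) = width (fst i) * (reply_prob (bmid i) v * log 2 (reply_prob (bmid i) v))"
      if "v \<in> {-1, 0, 1}" for v
      using i w unfolding p_eq prob_U1_U2[OF i that] by (simp add: q)
    then have "(\<Sum>v\<in>{-1, 0, 1}. ?f (v, i)) =
      (\<Sum>v\<in>{-1, 0, 1}. width (fst i) * (reply_prob (bmid i) v * log 2 (reply_prob (bmid i) v)))"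
      by (intro sum.cong) auto
    then show "(\<Sum>v\<in>{-1, 0, 1}. ?f (v, i)) = - (width (fst i) * vec_entropy (Q_vec \<rho> \<theta> M X (bmid i)))"
      using bin_bounds[OF i] by (simp add: Q_vec_eq vec_entropy_def algebra_simps)
  qed
  finally show ?thesis by (simp add: sum_negf)
qed

lemma error_prob_eq_sum:
  assumes "decision_rule \<rho> \<theta> N1 N2 dec"
  shows "error_prob \<rho> \<theta> N1 N2 M X dec = (\<Sum>i\<in>bins. measure lborel (bin_error i)) / s"
proof -
  \<comment> \<open>The index types are countable, so \<open>S\<close> is Borel; ranging over all
    indices also covers the fallback value of \<open>msg1\<close>.\<close>
  define S where "S = (\<Union>i. \<Union>v. msg_cell i v - V (dec i v))"
  let ?R = "rectangle \<rho> \<theta> N1 N2" and ?v = "{-1, 0, 1} :: int set"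
  have S: "S \<in> sets borel"
    unfolding S_def using msg_cell_borel voronoi_borel by (intro sets.countable_UN'' sets.Diff) simp_all
  have "error_prob \<rho> \<theta> N1 N2 M X dec = prob {\<omega> \<in> space M. X \<omega> \<in> S}"
  proof -
    have "X \<omega> \<in> S \<longleftrightarrow> X \<omega> \<notin> V (dec (u1 \<omega>) (u2 \<omega>))" for \<omega>
      unfolding S_def UN_iff Diff_iff U1_U2_iff[symmetric] by blast
    then show ?thesis by (simp add: error_prob_def)
  qed
  also have "\<dots> = measure lborel (B \<inter> S) / s" by (rule prob_X[OF S])
  also have "B \<inter> S = (\<Union>z\<in>bins \<times> ?v. ?R (fst z) (snd z) - V (dec (fst z) (snd z)))"
  proof (intro set_eqI iffI)
    fix p assume "p \<in> B \<inter> S"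
    then obtain i v where p: "p \<in> ?R i v" "p \<notin> V (dec i v)" by (auto simp: S_def rectangle_eq_msg_cell)
    have "msg2 \<rho> \<theta> N1 N2 i (snd p) \<in> ?v" by (simp add: msg2_def Let_def)
    then have "v \<in> ?v" using p(1) unfolding rectangle_def by blast
    moreover have "i \<in> bins"
      using p(1) msg1_in_bins[of "fst p"] unfolding rectangle_def B_eq mem_Times_iff by auto
    ultimately have "(i, v) \<in> bins \<times> ?v" by blast
    with p show "p \<in> (\<Union>z\<in>bins \<times> ?v. ?R (fst z) (snd z) - V (dec (fst z) (snd z)))" by force
  qed (auto simp: S_def rectangle_eq_msg_cell)
  also have "measure lborel \<dots> = (\<Sum>z\<in>bins \<times> ?v. measure lborel (?R (fst z) (snd z) - V (dec (fst z) (snd z))))"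
  proof (rule measure_UNION')
    show "pairwise (\<lambda>z z'. disjnt (?R (fst z) (snd z) - V (dec (fst z) (snd z)))
        (?R (fst z') (snd z') - V (dec (fst z') (snd z')))) (bins \<times> ?v)"
      by (auto simp: pairwise_def disjnt_def rectangle_def)
    show "?R (fst z) (snd z) - V (dec (fst z) (snd z)) \<in> fmeasurable lborel" if "z \<in> bins \<times> ?v" for z
      using that by (intro fmeasurable_Diff rectangle_fmeasurable)
        (simp_all only: sets_lborel voronoi_borel mem_Times_iff)
  qed (use finite_bins in simp)
  also have "\<dots> = (\<Sum>i\<in>bins. \<Sum>v\<in>?v. measure lborel (?R i v - V (dec i v)))"
    unfolding sum.cartesian_product' by simp
  \<comment> \<open>The given decision and \<open>decoded\<close> may differ at a tie, but they miss
    the same area of each rectangle because \<open>decoded\<close> covers at least half of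
    it.\<close>
  also have "\<dots> = (\<Sum>i\<in>bins. \<Sum>v\<in>?v. measure lborel (?R i v - V (decoded (fst i) v)))"
  proof (intro sum.cong refl)
    fix i v assume i: "i \<in> bins" and v: "v \<in> ?v"
    then show "measure lborel (?R i v - V (dec i v)) = measure lborel (?R i v - V (decoded (fst i) v))"
      using assms decoded_covers_half[of "fst i" "snd i" v] unfolding decision_rule_def
      by (intro measure_diff_voronoi_arg_max rectangle_fmeasurable decoded_in_lattice) auto
  qed
  also have "\<dots> = (\<Sum>i\<in>bins. measure lborel (bin_error i))"
  proof (intro sum.cong refl)
    fix i assume i: "i \<in> bins"
    show "(\<Sum>v\<in>?v. measure lborel (?R i v - V (decoded (fst i) v))) = measure lborel (bin_error i)"
      unfolding bin_error_def
    proof (rule measure_UNION'[symmetric])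
      show "pairwise (\<lambda>v v'. disjnt (?R i v - V (decoded (fst i) v)) (?R i v' - V (decoded (fst i) v'))) ?v"
        by (auto simp: pairwise_def disjnt_def rectangle_def)
      show "?R i v - V (decoded (fst i) v) \<in> fmeasurable lborel" if "v \<in> ?v" for v
        using rectangle_fmeasurable[OF i that] voronoi_borel by (simp add: fmeasurable_Diff)
    qed simp
  qed
  finally show ?thesis .
qed

end

section \<open>Closed forms and asymptotics\<close>

lemma sum_segments:
  "(\<Sum>j\<in>{-2..2::int}. f j) = f (-2) + f (-1) + f 0 + f 1 + (f 2 :: real)"
proof -
  have "{-2..2::int} = {-2, -1, 0, 1, 2}" by auto
  then show ?thesis by (simp add: add.assoc)
qed

text \<open>The exponents \<open>a\<close> and \<open>1 - a\<close> add up to 1, which cancels the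
  degree -1 of the error term and leaves only \<open>m / n\<close>.\<close>

lemma error_rate_trade_off:
  assumes "0 < m" "0 < (n::real)"
  shows "(A1 / m + A2 / n) * 2 powr (a * log 2 m + (1 - a) * log 2 n + z)
    = (A1 / (m / n) + A2) * (m / n) powr a * 2 powr z"
proof -
  have "2 powr (a * log 2 m + (1 - a) * log 2 n + z) = m powr a * n powr (1 - a) * 2 powr z"
    using assms by (simp add: powr_add powr_powr[symmetric] mult.commute[of a] mult.commute[of "1 - a"])
  also have "m powr a * n powr (1 - a) = (m / n) powr a * n"
    using assms by (simp add: powr_diff powr_divide)
  finally show ?thesis using assms by (simp add: field_simps)
qed

section \<open>Closed forms of the constants and of the reply entropy\<close>

context babai begin

text \<open>\<open>height21\<close> is the change of the one sloping boundary over an inner segment,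
  slope \<open>c / s\<close> times \<open>L1\<close>. \<open>height1\<close> and
  \<open>height22\<close> are the changes of the two boundaries over an outer segment; their slopes
  have total size \<open>1 / s\<close>, so the sum is \<open>L2 / s\<close>.\<close>

lemma alpha_eq:
  "alpha1 \<rho> \<theta> = c * (1 - 2 * c)\<^sup>2 / (8 * s\<^sup>2)" "alpha2 \<rho> \<theta> = c\<^sup>2 / (8 * s\<^sup>2)"
proof -
  have rho: "0 < \<rho>" and sin: "0 < sin \<theta>" using rho_ge_1 theta_pos theta_less by (auto intro: sin_gt_zero)
  have ratio: "cos \<theta> / sin \<theta> = c / s" using rho by (simp add: c_def s_def)
  have "height21 \<rho> \<theta> = (cos \<theta> / sin \<theta>) * (1 - 2 * c) / 2"
    "height1 \<rho> \<theta> + height22 \<rho> \<theta> = (cos \<theta> / sin \<theta>) / 2"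
    using sin by (simp_all add: height21_def height1_def height22_def c_def field_simps power2_eq_square)
  note heights = this[unfolded ratio]
  show "alpha1 \<rho> \<theta> = c * (1 - 2 * c)\<^sup>2 / (8 * s\<^sup>2)" "alpha2 \<rho> \<theta> = c\<^sup>2 / (8 * s\<^sup>2)"
    using s_pos unfolding alpha1_def alpha2_def heights seg_simps det_V_def s_def[symmetric]
    by (simp_all add: power2_eq_square field_simps)
qed

lemma alpha_pos: "0 < alpha1 \<rho> \<theta>" "0 < alpha2 \<rho> \<theta>"
  using c_pos c_less s_pos unfolding alpha_eq by simp_all

lemma one_minus_L0: "1 - L0 \<rho> \<theta> = 2 * (L1 \<rho> \<theta> + L2 \<rho> \<theta>)"
  by (simp add: seg_simps field_simps)

definition reply_entropy :: "real \<Rightarrow> real" where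
  "reply_entropy x = vec_entropy [reply_prob x (-1), reply_prob x 0, reply_prob x 1]"

lemma continuous_reply_entropy: "continuous_on {-(1/2)..1/2} reply_entropy"
proof -
  have uu: "continuous_on A uu" for A
    unfolding uu_def using s_pos by (intro continuous_intros) auto
  have ll: "continuous_on A ll" for A
    unfolding ll_def by (intro continuous_intros continuous_on_compose2[OF uu[of UNIV]]) auto
  have "continuous_on A (\<lambda>x. reply_prob x v)" for A v
    unfolding reply_prob_def using s_pos by (cases "v = 1"; cases "v = 0"; simp; intro continuous_intros uu ll) auto
  moreover have "(\<lambda>x. reply_prob x v) ` {-(1/2)..1/2} \<subseteq> {0..}" for v
    using reply_prob_nonneg[of _ v] by (auto simp: abs_le_iff)
  ultimately have "continuous_on {-(1/2)..1/2} (\<lambda>x. reply_prob x v * log 2 (reply_prob x v))" for v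
    by (intro continuous_on_compose2[OF continuous_on_x_log_x])
  note terms = this
  have "reply_entropy = (\<lambda>x. - (reply_prob x (-1) * log 2 (reply_prob x (-1))
      + reply_prob x 0 * log 2 (reply_prob x 0) + reply_prob x 1 * log 2 (reply_prob x 1)))"
    by (simp add: fun_eq_iff reply_entropy_def vec_entropy_def)
  then show ?thesis by (simp only:) (intro continuous_on_minus continuous_on_add terms)
qed

text \<open>Reflection exchanges the probabilities of the replies 1 and -1.\<close>

lemma reply_entropy_uminus: "reply_entropy (- x) = reply_entropy x"
  by (simp add: reply_entropy_def vec_entropy_def reply_prob_def ll_def algebra_simps)

text \<open>The single bin of the central segment has midpoint 0, so it contributes nothing to the
  conditional entropy.\<close>

lemma reply_entropy_0: "reply_entropy 0 = 0"
proof -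
  have "uu 0 = s/2" using uu_mid[of 0] c_pos c_less by simp
  moreover have "reply_prob 0 v = (if v = 0 then 1 else 0)" for v
    using s_pos calculation by (simp add: reply_prob_def ll_def)
  ultimately show ?thesis by (simp add: reply_entropy_def vec_entropy_def)
qed

definition segment_sum :: "int \<Rightarrow> nat \<Rightarrow> real" where
  "segment_sum j N = seg_len \<rho> \<theta> j / real N *
     (\<Sum>k<N. reply_entropy (seg_lo \<rho> \<theta> j + (real k + 1/2) * (seg_len \<rho> \<theta> j / real N)))"

lemma segment_sum_tendsto:
  assumes "j \<in> {-2..2}"
  shows "segment_sum j \<longlonglongrightarrow> integral {seg_lo \<rho> \<theta> j..seg_hi \<rho> \<theta> j} reply_entropy"
proof -
  have "continuous_on {seg_lo \<rho> \<theta> j..seg_hi \<rho> \<theta> j} reply_entropy"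
    using seg_bounds[OF assms] by (intro continuous_on_subset[OF continuous_reply_entropy]) auto
  moreover have "seg_lo \<rho> \<theta> j < seg_hi \<rho> \<theta> j"
    using seg_len_pos[OF assms] by (simp add: seg_len_def)
  ultimately show ?thesis
    unfolding segment_sum_def seg_len_def by (rule midpoint_sum_tendsto)
qed

end

context babai_bins begin

lemma sum_bins:
  "(\<Sum>i\<in>bins. f i) = (\<Sum>j\<in>{-2..2}. \<Sum>k<nb j. (f (j, k) :: real))"
  unfolding bin_indices_def by (subst sum.Sigma) auto

end

section \<open>Exact error probability and entropies for fixed bin numbers\<close>

context babai_scheme begin

lemma error_prob_eq:
  assumes "decision_rule \<rho> \<theta> N1 N2 dec"
  shows "error_prob \<rho> \<theta> N1 N2 M X dec = alpha1 \<rho> \<theta> / real N1 + alpha2 \<rho> \<theta> / real N2"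
proof -
  have "(\<Sum>i\<in>bins. measure lborel (bin_error i)) =
      (\<Sum>j\<in>{-2..2}. \<Sum>k<nb j. (\<bar>slope j\<bar> + \<bar>slope (- j)\<bar>) * (width j)\<^sup>2 / 4)"
    unfolding sum_bins by (intro sum.cong refl measure_bin_error) (simp add: bins_iff)
  also have "\<dots> = (\<Sum>j\<in>{-2..2}. (\<bar>slope j\<bar> + \<bar>slope (- j)\<bar>) * (seg_len \<rho> \<theta> j)\<^sup>2 / (4 * real (nb j)))"
    using nb_pos by (intro sum.cong refl) (simp add: power_divide power2_eq_square)
  also have "\<dots> = (c / s) * ((1 - 2 * c) / 2)\<^sup>2 / (2 * real N1) + (1 / s) * (c/2)\<^sup>2 / (2 * real N2)"
  proof -
    \<comment> \<open>On an outer segment both boundaries slope, by \<open>(1 - c) / s\<close> and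
      \<open>c / s\<close>; on an inner one the other boundary is flat.\<close>
    have "\<bar>slope (-2)\<bar> + \<bar>slope 2\<bar> = 1 / s" "\<bar>slope (-1)\<bar> + \<bar>slope 1\<bar> = c / s" "slope 0 = 0"
      using c_pos c_less s_pos by (simp_all add: slope_def field_simps)
    then show ?thesis
      unfolding sum_segments by (simp add: seg_simps num_bins_def add.commute field_simps)
  qed
  finally have "error_prob \<rho> \<theta> N1 N2 M X dec =
      ((c / s) * ((1 - 2 * c) / 2)\<^sup>2 / (2 * real N1) + (1 / s) * (c/2)\<^sup>2 / (2 * real N2)) / s"
    unfolding error_prob_eq_sum[OF assms] by simp
  also have "\<dots> = alpha1 \<rho> \<theta> / real N1 + alpha2 \<rho> \<theta> / real N2"
    using s_pos N_pos unfolding alpha_eq by (simp add: field_simps power2_eq_square)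
  finally show ?thesis .
qed

text \<open>The grouping rule for entropy: first the segment, with law \<open>P_vec\<close>, then a
  uniformly distributed bin inside it.\<close>

lemma bits_U1_eq:
  "bits M u1 = vec_entropy (P_vec \<rho> \<theta>) + 2 * L1 \<rho> \<theta> * log 2 (real N1) + 2 * L2 \<rho> \<theta> * log 2 (real N2)"
proof -
  have "(\<Sum>i\<in>bins. width (fst i) * log 2 (width (fst i))) =
      (\<Sum>j\<in>{-2..2}. seg_len \<rho> \<theta> j * (log 2 (seg_len \<rho> \<theta> j) - log 2 (real (nb j))))"
    unfolding sum_bins using nb_pos seg_len_pos by (intro sum.cong refl) (simp add: log_divide)
  also have "\<dots> = - (vec_entropy (P_vec \<rho> \<theta>) + 2 * L1 \<rho> \<theta> * log 2 (real N1) + 2 * L2 \<rho> \<theta> * log 2 (real N2))"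
    unfolding sum_segments by (simp add: seg_simps num_bins_def vec_entropy_def P_vec_def field_simps)
  finally show ?thesis unfolding bits_U1 by simp
qed

lemma cond_bits_eq:
  "cond_bits M u2 u1 = segment_sum (-2) N2 + segment_sum (-1) N1 + segment_sum 1 N1 + segment_sum 2 N2"
proof -
  have mid: "bmid (j, k) = seg_lo \<rho> \<theta> j + (real k + 1/2) * width j" for j k
  proof -
    have "m = x + (real k + 1/2) * w" if "x + real k * w = m - w / 2" for x m w
      using that by (simp add: algebra_simps)
    then show ?thesis using bin_mid_eq(1)[of j k] unfolding bin_ends by blast
  qed
  have "cond_bits M u2 u1 = (\<Sum>i\<in>bins. width (fst i) * reply_entropy (bmid i))"
    unfolding cond_bits_U2_U1
  proof (intro sum.cong refl)
    fix i assume i: "i \<in> bins"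
    have "- (1/2) < bmid i" "bmid i \<le> 1/2" using bin_bounds[OF i] by auto
    from Q_vec_eq[OF this]
    show "width (fst i) * vec_entropy (Q_vec \<rho> \<theta> M X (bmid i)) = width (fst i) * reply_entropy (bmid i)"
      by (simp add: reply_entropy_def)
  qed
  also have "\<dots> = (\<Sum>j\<in>{-2..2}. segment_sum j (nb j))"
    unfolding sum_bins segment_sum_def fst_conv mid sum_distrib_left ..
  also have "\<dots> = segment_sum (-2) N2 + segment_sum (-1) N1 + segment_sum 1 N1 + segment_sum 2 N2"
    unfolding sum_segments by (simp add: num_bins_def segment_sum_def[of 0] seg_simps reply_entropy_0)
  finally show ?thesis .
qed

end

section \<open>The constant \<open>kappa\<close>\<close>

context babai_source begin

lemma kappa_integral:
  "(\<lambda>x. vec_entropy (Q_vec \<rho> \<theta> M X x)) integrable_on {-(1/2)..- t1 \<rho> \<theta>}"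
  "kappa \<rho> \<theta> M X = 2 * integral {-(1/2)..-c/2} reply_entropy"
proof -
  have t1: "- t1 \<rho> \<theta> = -c/2" by (simp add: t1_def c_def)
  have "continuous_on {-(1/2)..-c/2} reply_entropy"
    using c_pos c_less by (intro continuous_on_subset[OF continuous_reply_entropy]) auto
  then have int: "reply_entropy integrable_on {-(1/2)..-c/2}" by (rule integrable_continuous_real)
  \<comment> \<open>At \<open>x = -(1/2)\<close> the slice is empty, since the Babai cell is open on
    the left, and its ends are default values. One point does not affect the integral.\<close>
  have eq: "vec_entropy (Q_vec \<rho> \<theta> M X x) = reply_entropy x" if "x \<in> {-(1/2)..-c/2} - {-(1/2)}" for x
    using that c_pos Q_vec_eq[of x] by (simp add: reply_entropy_def)
  show "(\<lambda>x. vec_entropy (Q_vec \<rho> \<theta> M X x)) integrable_on {-(1/2)..- t1 \<rho> \<theta>}"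
    unfolding t1 by (rule integrable_spike_finite[of "{-(1/2)}", OF _ _ int]) (use eq in auto)
  have "integral {-(1/2)..-c/2} (\<lambda>x. vec_entropy (Q_vec \<rho> \<theta> M X x)) = integral {-(1/2)..-c/2} reply_entropy"
    by (rule integral_spike[of "{-(1/2)}"]) (use eq in auto)
  then show "kappa \<rho> \<theta> M X = 2 * integral {-(1/2)..-c/2} reply_entropy"
    unfolding kappa_def t1 by simp
qed

text \<open>The factor 2 in \<open>kappa\<close> accounts for the right half of the strip, by the
  symmetry of \<open>reply_entropy\<close>; the central segment is absent on both sides.\<close>

lemma kappa_eq_segments:
  "kappa \<rho> \<theta> M X =
     integral {seg_lo \<rho> \<theta> (-2)..seg_hi \<rho> \<theta> (-2)} reply_entropy
   + integral {seg_lo \<rho> \<theta> (-1)..seg_hi \<rho> \<theta> (-1)} reply_entropy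
   + integral {seg_lo \<rho> \<theta> 1..seg_hi \<rho> \<theta> 1} reply_entropy
   + integral {seg_lo \<rho> \<theta> 2..seg_hi \<rho> \<theta> 2} reply_entropy"
proof -
  have "continuous_on {-(1/2)..-c/2} reply_entropy"
    using c_pos c_less by (intro continuous_on_subset[OF continuous_reply_entropy]) auto
  then have int: "reply_entropy integrable_on {-(1/2)..-c/2}" by (rule integrable_continuous_real)
  have "integral {-(1/2)..-c/2} reply_entropy
     = integral {-(1/2)..(c - 1)/2} reply_entropy + integral {(c - 1)/2..-c/2} reply_entropy"
    using c_pos c_less by (intro Henstock_Kurzweil_Integration.integral_combine[symmetric] int) auto
  moreover have reflect: "integral {- b..- a} reply_entropy = integral {a..b} reply_entropy" for a b
    using Henstock_Kurzweil_Integration.integral_reflect_real[of b a reply_entropy]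
    by (simp add: reply_entropy_uminus)
  have "integral {-(1/2)..(c - 1)/2} reply_entropy = integral {(1 - c)/2..1/2} reply_entropy"
    "integral {(c - 1)/2..-c/2} reply_entropy = integral {c/2..(1 - c)/2} reply_entropy"
    using reflect[of "1/2" "(1 - c)/2"] reflect[of "(1 - c)/2" "c/2"]
    by (simp_all only: minus_divide_left minus_diff_eq)
  ultimately show ?thesis unfolding kappa_integral seg_simps by linarith
qed

end

section \<open>Coupling of the two bin numbers\<close>

context babai begin

text \<open>The minimizer over \<open>r > 0\<close> of
  \<open>(alpha1 / r + alpha2) * r powr (L1 / (L1 + L2))\<close>, the part of the limit that depends
  on \<open>r = N1 / N2\<close>: the derivative vanishes when
  \<open>L2 * alpha1 = L1 * alpha2 * r\<close>.\<close>

definition bin_ratio :: real where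
  "bin_ratio = alpha1 \<rho> \<theta> * L2 \<rho> \<theta> / (alpha2 \<rho> \<theta> * L1 \<rho> \<theta>)"

lemma bin_ratio_pos: "0 < bin_ratio"
  using alpha_pos c_pos c_less by (simp add: bin_ratio_def seg_simps)

lemma N1_of_bounds:
  "bin_ratio * real N \<le> real (N1_of \<rho> \<theta> N)" "real (N1_of \<rho> \<theta> N) \<le> bin_ratio * real N + 1"
proof -
  have "0 \<le> bin_ratio * real N" using bin_ratio_pos by simp
  moreover have "N1_of \<rho> \<theta> N = nat \<lceil>bin_ratio * real N\<rceil>"
    by (simp add: N1_of_def bin_ratio_def)
  ultimately show "bin_ratio * real N \<le> real (N1_of \<rho> \<theta> N)"
    "real (N1_of \<rho> \<theta> N) \<le> bin_ratio * real N + 1"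
    by linarith+
qed

lemma N1_of_pos: "0 < N \<Longrightarrow> 0 < N1_of \<rho> \<theta> N"
  using N1_of_bounds(1)[of N] bin_ratio_pos by (metis mult_pos_pos of_nat_0_less_iff order_less_le_trans)

lemma filterlim_N1_of: "filterlim (N1_of \<rho> \<theta>) at_top sequentially"
proof -
  have "filterlim (\<lambda>N. bin_ratio * real N) at_top sequentially"
    by (intro filterlim_tendsto_pos_mult_at_top[OF tendsto_const bin_ratio_pos] filterlim_real_sequentially)
  then have "filterlim (\<lambda>N. real (N1_of \<rho> \<theta> N)) at_top sequentially"
    by (rule filterlim_at_top_mono) (simp add: N1_of_bounds)
  then show ?thesis by (simp add: filterlim_sequentially_iff_filterlim_real)
qed

lemma N1_of_ratio_tendsto: "(\<lambda>N. real (N1_of \<rho> \<theta> N) / real N) \<longlonglongrightarrow> bin_ratio"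
proof (rule tendsto_sandwich)
  show "(\<lambda>N. bin_ratio) \<longlonglongrightarrow> bin_ratio" by simp
  have "(\<lambda>N. bin_ratio + 1 / real N) \<longlonglongrightarrow> bin_ratio + 0"
    by (intro tendsto_intros lim_1_over_n)
  then show "(\<lambda>N. bin_ratio + 1 / real N) \<longlonglongrightarrow> bin_ratio" by simp
  show "\<forall>\<^sub>F N in sequentially. bin_ratio \<le> real (N1_of \<rho> \<theta> N) / real N"
    using eventually_gt_at_top[of 0]
    by eventually_elim (use N1_of_bounds(1) in \<open>simp add: pos_le_divide_eq\<close>)
  show "\<forall>\<^sub>F N in sequentially. real (N1_of \<rho> \<theta> N) / real N \<le> bin_ratio + 1 / real N"
    using eventually_gt_at_top[of 0]
    by eventually_elim (use N1_of_bounds(2) in \<open>simp add: pos_divide_le_eq distrib_right\<close>)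
qed

end

section \<open>Limits as \<open>N2\<close> grows\<close>

context babai_source begin

lemma scheme: "0 < N1 \<Longrightarrow> 0 < N2 \<Longrightarrow> babai_scheme \<rho> \<theta> M X N1 N2"
  by unfold_locales auto

abbreviation "cond_bits_at N \<equiv>
  cond_bits M (U2 \<rho> \<theta> (N1_of \<rho> \<theta> N) N X) (U1 \<rho> \<theta> (N1_of \<rho> \<theta> N) N X)"
abbreviation "rate_at N \<equiv> rate \<rho> \<theta> (N1_of \<rho> \<theta> N) N M X"

lemma cond_bits_tendsto: "cond_bits_at \<longlonglongrightarrow> kappa \<rho> \<theta> M X"
proof (rule Lim_transform_eventually)
  note lim = segment_sum_tendsto filterlim_compose[OF segment_sum_tendsto filterlim_N1_of]
  show "(\<lambda>N. segment_sum (-2) N + segment_sum (-1) (N1_of \<rho> \<theta> N)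
      + segment_sum 1 (N1_of \<rho> \<theta> N) + segment_sum 2 N) \<longlonglongrightarrow> kappa \<rho> \<theta> M X"
    unfolding kappa_eq_segments by (intro tendsto_add lim) simp_all
  show "\<forall>\<^sub>F N in sequentially. segment_sum (-2) N + segment_sum (-1) (N1_of \<rho> \<theta> N)
      + segment_sum 1 (N1_of \<rho> \<theta> N) + segment_sum 2 N = cond_bits_at N"
    using eventually_gt_at_top[of 0]
    by eventually_elim (simp add: babai_scheme.cond_bits_eq[OF scheme] N1_of_pos)
qed

lemma rate_at_eq:
  assumes "0 < N"
  shows "rate_at N = vec_entropy (P_vec \<rho> \<theta>) + 2 * L1 \<rho> \<theta> * log 2 (real (N1_of \<rho> \<theta> N))
    + 2 * L2 \<rho> \<theta> * log 2 (real N) + cond_bits_at N"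
  using babai_scheme.bits_U1_eq[OF scheme[OF N1_of_pos[OF assms] assms]] by (simp add: rate_def)

text \<open>The term \<open>2 * L2 * log 2 N2\<close> alone diverges; the conditional entropy
  converges and the \<open>N1\<close> term is non-negative because \<open>N1\<close> is at least
  1.\<close>

lemma rate_tendsto: "filterlim rate_at at_top sequentially"
proof (rule filterlim_at_top_mono)
  have "filterlim (\<lambda>N. inverse (ln 2) * ln (real N)) at_top sequentially"
    by (intro filterlim_tendsto_pos_mult_at_top[OF tendsto_const]
        filterlim_compose[OF ln_at_top filterlim_real_sequentially]) simp
  then have "filterlim (\<lambda>N. log 2 (real N)) at_top sequentially"
    by (simp only: log_def divide_inverse mult.commute)
  then have "filterlim (\<lambda>N. 2 * L2 \<rho> \<theta> * log 2 (real N)) at_top sequentially"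
    using c_pos by (intro filterlim_tendsto_pos_mult_at_top[OF tendsto_const]) (simp add: seg_simps)
  then show "filterlim (\<lambda>N. vec_entropy (P_vec \<rho> \<theta>) + cond_bits_at N + 2 * L2 \<rho> \<theta> * log 2 (real N))
      at_top sequentially"
    by (intro filterlim_tendsto_add_at_top[OF tendsto_add[OF tendsto_const cond_bits_tendsto]])
  show "\<forall>\<^sub>F N in sequentially.
      vec_entropy (P_vec \<rho> \<theta>) + cond_bits_at N + 2 * L2 \<rho> \<theta> * log 2 (real N) \<le> rate_at N"
    using eventually_gt_at_top[of 0]
  proof eventually_elim
    case (elim N)
    have "1 \<le> real (N1_of \<rho> \<theta> N)" using N1_of_pos[OF elim] by simp
    then have "0 \<le> 2 * L1 \<rho> \<theta> * log 2 (real (N1_of \<rho> \<theta> N))"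
      using seg_len_pos[of 1] by (intro mult_nonneg_nonneg) auto
    then show ?case unfolding rate_at_eq[OF elim] by linarith
  qed
qed

lemma error_rate_tendsto:
  assumes dec: "\<And>N1 N2. N1 > 0 \<Longrightarrow> N2 > 0 \<Longrightarrow> decision_rule \<rho> \<theta> N1 N2 (dec N1 N2)"
  shows "(\<lambda>N. error_prob \<rho> \<theta> (N1_of \<rho> \<theta> N) N M X (dec (N1_of \<rho> \<theta> N) N)
      * 2 powr (rate_at N / (1 - L0 \<rho> \<theta>)))
    \<longlonglongrightarrow> alpha2 \<rho> \<theta> * (1 + L1 \<rho> \<theta> / L2 \<rho> \<theta>) * bin_ratio powr (L1 \<rho> \<theta> / (L1 \<rho> \<theta> + L2 \<rho> \<theta>))
      * 2 powr ((kappa \<rho> \<theta> M X + vec_entropy (P_vec \<rho> \<theta>)) / (1 - L0 \<rho> \<theta>))"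
proof (rule Lim_transform_eventually)
  let ?a = "L1 \<rho> \<theta> / (L1 \<rho> \<theta> + L2 \<rho> \<theta>)"
  let ?q = "\<lambda>N. real (N1_of \<rho> \<theta> N) / real N"
  let ?z = "\<lambda>N. (cond_bits_at N + vec_entropy (P_vec \<rho> \<theta>)) / (1 - L0 \<rho> \<theta>)"
  have L: "0 < L1 \<rho> \<theta>" "0 < L2 \<rho> \<theta>" using seg_len_pos by auto
  \<comment> \<open>At this ratio \<open>alpha1 / bin_ratio = alpha2 * L1 / L2\<close>, which
    produces the factor \<open>1 + L1 / L2\<close>.\<close>
  have "alpha1 \<rho> \<theta> / bin_ratio + alpha2 \<rho> \<theta> = alpha2 \<rho> \<theta> * (1 + L1 \<rho> \<theta> / L2 \<rho> \<theta>)"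
    using alpha_pos L by (simp add: bin_ratio_def field_simps)
  moreover have "(\<lambda>N. (alpha1 \<rho> \<theta> / ?q N + alpha2 \<rho> \<theta>) * ?q N powr ?a * 2 powr ?z N)
    \<longlonglongrightarrow> (alpha1 \<rho> \<theta> / bin_ratio + alpha2 \<rho> \<theta>) * bin_ratio powr ?a
      * 2 powr ((kappa \<rho> \<theta> M X + vec_entropy (P_vec \<rho> \<theta>)) / (1 - L0 \<rho> \<theta>))"
    using bin_ratio_pos one_minus_L0 L
    by (intro tendsto_intros N1_of_ratio_tendsto cond_bits_tendsto) auto
  ultimately show "(\<lambda>N. (alpha1 \<rho> \<theta> / ?q N + alpha2 \<rho> \<theta>) * ?q N powr ?a * 2 powr ?z N)
    \<longlonglongrightarrow> alpha2 \<rho> \<theta> * (1 + L1 \<rho> \<theta> / L2 \<rho> \<theta>) * bin_ratio powr ?a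
      * 2 powr ((kappa \<rho> \<theta> M X + vec_entropy (P_vec \<rho> \<theta>)) / (1 - L0 \<rho> \<theta>))"
    by simp
  show "\<forall>\<^sub>F N in sequentially. (alpha1 \<rho> \<theta> / ?q N + alpha2 \<rho> \<theta>) * ?q N powr ?a * 2 powr ?z N =
    error_prob \<rho> \<theta> (N1_of \<rho> \<theta> N) N M X (dec (N1_of \<rho> \<theta> N) N) * 2 powr (rate_at N / (1 - L0 \<rho> \<theta>))"
    using eventually_gt_at_top[of 0]
  proof eventually_elim
    case (elim N)
    note N1 = N1_of_pos[OF elim]
    have "rate_at N / (1 - L0 \<rho> \<theta>)
        = ?a * log 2 (real (N1_of \<rho> \<theta> N)) + (1 - ?a) * log 2 (real N) + ?z N"
    proof -
      \<comment> \<open>With \<open>D = L1 + L2\<close>, division by \<open>1 - L0 = 2 * D\<close>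
        turns the logarithmic coefficients into weights of sum 1, as
        \<open>error_rate_trade_off\<close> requires.\<close>
      have split: "(p + 2 * l * x + 2 * l' * y + k) / (2 * D) = l / D * x + l' / D * y + (k + p) / (2 * D)"
        if "0 < D" for p l x l' y k D :: real
        using that by (simp add: add_divide_distrib)
      have "1 - ?a = L2 \<rho> \<theta> / (L1 \<rho> \<theta> + L2 \<rho> \<theta>)" using L by (simp add: field_simps)
      then show ?thesis
        unfolding rate_at_eq[OF elim] one_minus_L0 using L by (simp only:) (rule split, simp)
    qed
    then show ?case
      using error_rate_trade_off[of "real (N1_of \<rho> \<theta> N)" "real N" "alpha1 \<rho> \<theta>" "alpha2 \<rho> \<theta>" ?a "?z N"] N1 elim
        babai_scheme.error_prob_eq[OF scheme[OF N1 elim] dec[OF N1 elim]] by simp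
  qed
qed

end

theorem mainTheorem2:
  fixes \<rho> \<theta> :: real
    and M :: "'a measure"
    and X :: "'a \<Rightarrow> real \<times> real"
    and dec :: "nat \<Rightarrow> nat \<Rightarrow> int \<times> nat \<Rightarrow> int \<Rightarrow> real \<times> real"
  assumes "\<rho> \<ge> 1" and "0 < \<theta>" and "\<theta> < pi / 2"
    and "0 < \<rho> * cos \<theta>" and "\<rho> * cos \<theta> < 1 / 2"
    and "prob_space M"
    and "X \<in> borel_measurable M"
    and "distr M lborel X = uniform_measure lborel (babai_cell \<rho> \<theta>)"
    and "\<And>N1 N2. N1 > 0 \<Longrightarrow> N2 > 0 \<Longrightarrow> decision_rule \<rho> \<theta> N1 N2 (dec N1 N2)"
  shows "(\<forall>N1 > 0. \<forall>N2 > 0.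
            error_prob \<rho> \<theta> N1 N2 M X (dec N1 N2) =
              alpha1 \<rho> \<theta> / real N1 + alpha2 \<rho> \<theta> / real N2)
    \<and> filterlim (\<lambda>N2. rate \<rho> \<theta> (N1_of \<rho> \<theta> N2) N2 M X) at_top sequentially
    \<and> (\<lambda>x. vec_entropy (Q_vec \<rho> \<theta> M X x)) integrable_on {-(1/2)..- t1 \<rho> \<theta>}
    \<and> (\<lambda>N2. cond_bits M (U2 \<rho> \<theta> (N1_of \<rho> \<theta> N2) N2 X) (U1 \<rho> \<theta> (N1_of \<rho> \<theta> N2) N2 X))
        \<longlonglongrightarrow> kappa \<rho> \<theta> M X
    \<and> (\<lambda>N2. error_prob \<rho> \<theta> (N1_of \<rho> \<theta> N2) N2 M X (dec (N1_of \<rho> \<theta> N2) N2)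
             * 2 powr (rate \<rho> \<theta> (N1_of \<rho> \<theta> N2) N2 M X / (1 - L0 \<rho> \<theta>)))
        \<longlonglongrightarrow> alpha2 \<rho> \<theta> * (1 + L1 \<rho> \<theta> / L2 \<rho> \<theta>)
             * (alpha1 \<rho> \<theta> * L2 \<rho> \<theta> / (alpha2 \<rho> \<theta> * L1 \<rho> \<theta>))
                 powr (L1 \<rho> \<theta> / (L1 \<rho> \<theta> + L2 \<rho> \<theta>))
             * 2 powr ((kappa \<rho> \<theta> M X + vec_entropy (P_vec \<rho> \<theta>)) / (1 - L0 \<rho> \<theta>))"
proof -
  interpret prob_space M by fact
  interpret babai_source \<rho> \<theta> M X by unfold_locales (use assms in auto)
  have "error_prob \<rho> \<theta> N1 N2 M X (dec N1 N2) = alpha1 \<rho> \<theta> / real N1 + alpha2 \<rho> \<theta> / real N2"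
    if "N1 > 0" "N2 > 0" for N1 N2
    using babai_scheme.error_prob_eq[OF scheme[OF that] assms(9)[OF that]] .
  then show ?thesis
    using rate_tendsto kappa_integral(1) cond_bits_tendsto error_rate_tendsto[of dec, OF assms(9)]
    unfolding bin_ratio_def by blast
qed

end
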